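(* Let $\Omega\subset\mathbb{R}^d$ be a bounded $C^2$ domain, and let $\mu(dx)=\rho(x)\,dx$ be a probability measure on $\Omega$ whose density $\rho$ is uniformly continuous on $\Omega$ and satisfies $1/\rho^*<\rho(x)<\rho^*$ for all $x\in\Omega$, for some constant $\rho^*$. Let $X_1,X_2,\dots$ be independent random variables with law $\mu$, let $\kappa>0$, and let $(h_n)$ be a sequence of positive numbers with $h_n\to 0$ and $nh_n^d/\log(n)\to\infty$. Suppose that, almost surely, for all sufficiently large $n$ and every $x\in\Omega$, $\widehat\sigma_n(x)>0$ is chosen so that $$\mathrm{PP}_n\big(x\,|\,h_n\widehat\sigma_n(x)\big)=\kappa\, n h_n^d .$$ Then for every $\tilde\Omega\subset\subset\Omega$, $$\lim_{n\to\infty}\left\|\widehat\sigma_n(x)-\frac{1}{\sqrt{2\pi e}}\left(\frac{\kappa}{\rho(x)}\right)^{1/d}\right\|_{L^\infty(\tilde\Omega)}=0\qquad\text{almost surely.}$$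
   Context: For $x\in\mathbb{R}^d$ and $\sigma>0$, the perplexity at $x$ with bandwidth $\sigma$ for the sample $X_1,\dots,X_n$ is $$\mathrm{PP}_n(x\,|\,\sigma)=\left(\sum_{k=1}^n\exp\left(-\frac{|x-X_k|^2}{2\sigma^2}\right)\right)\exp\left(\frac{\sum_{k=1}^n\frac{|x-X_k|^2}{2\sigma^2}\exp\left(-\frac{|x-X_k|^2}{2\sigma^2}\right)}{\sum_{k=1}^n\exp\left(-\frac{|x-X_k|^2}{2\sigma^2}\right)}\right).$$ Equivalently it is $\exp$ of the Shannon entropy (base $e$) of the probability vector proportional to $\exp(-|x-X_k|^2/(2\sigma^2))$, $k=1,\dots,n$. The notation $\tilde\Omega\subset\subset\Omega$ means that the closure of $\tilde\Omega$ is a compact subset of $\Omega$. *)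

theory Defs
  imports "HOL-Probability.Probability"
begin

definition C2_function :: "('a::euclidean_space \<Rightarrow> real) \<Rightarrow> bool" where
  "C2_function f \<longleftrightarrow>
     (\<exists>(f' :: 'a \<Rightarrow> 'a \<Rightarrow>\<^sub>L real) (f'' :: 'a \<Rightarrow> 'a \<Rightarrow>\<^sub>L ('a \<Rightarrow>\<^sub>L real)).
        (\<forall>x. (f has_derivative blinfun_apply (f' x)) (at x)) \<and>
        (\<forall>x. (f' has_derivative blinfun_apply (f'' x)) (at x)) \<and>
        continuous_on UNIV f'')"

text \<open>Near each boundary point the set is, in suitably rotated coordinates, the part of a ball lying
  strictly above the graph of a \<open>C\<^sup>2\<close> function. The vertical axis is the unit vector \<open>e\<close>, and
  \<open>x - (x \<bullet> e) *\<^sub>R e\<close> is the projection of \<open>x\<close> to the hyperplane orthogonal to \<open>e\<close>; only the values of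
  \<open>\<gamma>\<close> on that hyperplane matter, and a \<open>C\<^sup>2\<close> function on the hyperplane extends to the whole space by
  composing with the projection.\<close>

definition C2_boundary :: "'a::euclidean_space set \<Rightarrow> bool" where
  "C2_boundary \<Omega> \<longleftrightarrow>
     (\<forall>p \<in> frontier \<Omega>. \<exists>r>0. \<exists>e \<gamma>. norm e = 1 \<and> C2_function \<gamma> \<and>
        \<Omega> \<inter> ball p r = {x \<in> ball p r. \<gamma> (x - (x \<bullet> e) *\<^sub>R e) < x \<bullet> e})"

definition C2_domain :: "'a::euclidean_space set \<Rightarrow> bool" where
  "C2_domain \<Omega> \<longleftrightarrow> open \<Omega> \<and> connected \<Omega> \<and> \<Omega> \<noteq> {} \<and> C2_boundary \<Omega>"

text \<open>The sample points are \<open>X 1, \<dots>, X n\<close>; the value \<open>X 0\<close> is not used.\<close>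

definition perplexity :: "(nat \<Rightarrow> 'a::euclidean_space) \<Rightarrow> nat \<Rightarrow> 'a \<Rightarrow> real \<Rightarrow> real" where
  "perplexity X n x \<sigma> =
     (\<Sum>k=1..n. exp (- ((norm (x - X k))\<^sup>2 / (2 * \<sigma>\<^sup>2)))) *
     exp ((\<Sum>k=1..n. (norm (x - X k))\<^sup>2 / (2 * \<sigma>\<^sup>2) * exp (- ((norm (x - X k))\<^sup>2 / (2 * \<sigma>\<^sup>2)))) /
          (\<Sum>k=1..n. exp (- ((norm (x - X k))\<^sup>2 / (2 * \<sigma>\<^sup>2)))))"

text \<open>The least essential bound of \<open>\<bar>f\<bar>\<close> on \<open>S\<close> with respect to Lebesgue measure. It makes sense
  without measurability of \<open>S\<close> or \<open>f\<close>, where the library's \<open>esssup\<close> degenerates (it is \<open>top\<close> for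
  non-measurable functions); in the measurable case the two agree, see \<open>Linf_norm_eq_esssup\<close>.\<close>

definition Linf_norm :: "'a::euclidean_space set \<Rightarrow> ('a \<Rightarrow> real) \<Rightarrow> ennreal" where
  "Linf_norm S f = Inf {C. AE x in lebesgue. x \<in> S \<longrightarrow> ennreal \<bar>f x\<bar> \<le> C}"

lemma Linf_norm_eq_esssup:
  fixes f :: "'a::euclidean_space \<Rightarrow> real"
  assumes S: "S \<in> sets lebesgue" and f: "f \<in> borel_measurable (lebesgue_on S)"
  shows "Linf_norm S f = esssup (lebesgue_on S) (\<lambda>x. ennreal \<bar>f x\<bar>)"
proof -
  have "(\<lambda>x. ennreal \<bar>f x\<bar>) \<in> borel_measurable (lebesgue_on S)"
    using f by measurable
  then show ?thesis
    using S by (simp add: Linf_norm_def esssup_eq_AE AE_restrict_space_iff)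
qed

end

theory Submission
  imports Defs
begin

text \<open>
Both sums in the perplexity are kernel sums. For bandwidth \<open>h\<close> and the kernels
\<open>\<phi> u = exp (- \<bar>u\<bar>\<^sup>2 / 2)\<close> and \<open>\<psi> u = \<bar>u\<bar>\<^sup>2 / 2 * exp (- \<bar>u\<bar>\<^sup>2 / 2)\<close> they are sums of \<open>\<phi> ((x - X k) / h)\<close>
and \<open>\<psi> ((x - X k) / h)\<close>, and a law of large numbers suggests that they are close to
\<open>n h ^ d \<rho> x\<close> times the integrals of \<open>\<phi>\<close> and \<open>\<psi>\<close>. These integrals are \<open>(2 pi) ^ (d / 2)\<close> and
\<open>d / 2\<close> times as much, so the perplexity is asymptotically \<open>n h ^ d \<rho> x (2 pi e) ^ (d / 2)\<close>. Solving
for the bandwidth that gives the value \<open>\<kappa> n h ^ d\<close> yields the limit in the theorem.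

Two points make this rigorous. The law of large numbers has to hold almost surely and uniformly in \<open>x\<close>.
Its stochastic part, \<open>uniform_kernel_concentration\<close>, combines a Chernoff bound, a union bound over a net
of polynomial size and the Borel-Cantelli lemma, and this is where \<open>n h ^ d\<close> has to dominate \<open>ln n\<close>. Its
deterministic part, \<open>kernel_mean_tendsto\<close>, is dominated convergence with a uniformly continuous density
on a compact subset of the domain. Together they give \<open>perplexity_tendsto\<close>.

Furthermore, the asymptotics for prescribed bandwidths have to be inverted for the bandwidth that is
implicitly selected. By \<open>perplexity_mono\<close> the perplexity increases with the bandwidth, being the
exponential of the entropy of a Gibbs distribution at temperature proportional to the squared
bandwidth. In \<open>bandwidth_close\<close> the selected bandwidth is therefore enclosed between the elements of a
finite grid of deterministic multiples of \<open>h n\<close>.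
\<close>

section \<open>Monotonicity of the perplexity in the bandwidth\<close>

text \<open>This is Jensen's inequality for the Gibbs weights at inverse temperature \<open>b\<close>. In logarithms it says
that the convex function \<open>ln Z\<close> lies above its tangent at \<open>b\<close>, whose slope is minus the mean
energy \<open>U b\<close>. The proof sums the tangent inequality of the exponential at the mean exponent, where
the linear terms cancel.\<close>

lemma gibbs_tangent:
  fixes a :: "'i \<Rightarrow> real"
  assumes "finite A" "A \<noteq> {}"
  defines "Z \<equiv> \<lambda>b. \<Sum>k\<in>A. exp (- (b * a k))"
  defines "U \<equiv> \<lambda>b. (\<Sum>k\<in>A. a k * exp (- (b * a k))) / Z b"
  shows "Z b * exp ((b - c) * U b) \<le> Z c"
proof -
  define m where "m = (b - c) * U b"
  have Zpos: "Z b > 0"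
    unfolding Z_def using assms by (intro sum_pos) auto
  have "Z b * exp m = exp m * (Z b + (b - c) * (Z b * U b) - m * Z b)"
    by (simp add: m_def algebra_simps)
  also have "Z b * U b = (\<Sum>k\<in>A. a k * exp (- (b * a k)))"
    using Zpos by (simp add: U_def)
  also have "exp m * (Z b + (b - c) * (\<Sum>k\<in>A. a k * exp (- (b * a k))) - m * Z b) =
     (\<Sum>k\<in>A. exp (- (b * a k)) * (exp m * (1 + ((b - c) * a k - m))))"
    by (simp add: Z_def sum_distrib_left sum_distrib_right sum.distrib sum_subtractf algebra_simps)
  also have "\<dots> \<le> (\<Sum>k\<in>A. exp (- (b * a k)) * (exp m * exp ((b - c) * a k - m)))"
    by (intro sum_mono mult_left_mono exp_ge_add_one_self) auto
  also have "\<dots> = Z c"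
    unfolding Z_def
    by (intro sum.cong refl) (simp add: exp_add [symmetric] algebra_simps)
  finally show ?thesis by (simp add: m_def)
qed

text \<open>\<open>Z b * exp (b * U b)\<close> is the exponential of the entropy of the Gibbs weights. The tangents of
\<open>ln Z\<close> at \<open>b\<close> and at \<open>c\<close> together force \<open>U\<close> to decrease; inserting this into the tangent at \<open>c\<close>
gives the claim.\<close>

lemma gibbs_entropy_antimono:
  fixes a :: "'i \<Rightarrow> real"
  assumes "finite A" "A \<noteq> {}" "0 \<le> b" "b \<le> c"
  defines "Z \<equiv> \<lambda>b. \<Sum>k\<in>A. exp (- (b * a k))"
  defines "U \<equiv> \<lambda>b. (\<Sum>k\<in>A. a k * exp (- (b * a k))) / Z b"
  shows "Z c * exp (c * U c) \<le> Z b * exp (b * U b)"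
proof (cases "b = c")
  case False
  with assms have "b < c" by simp
  have Zpos: "Z b > 0" for b
    unfolding Z_def using assms(1,2) by (intro sum_pos) auto
  have tan: "ln (Z b) + (b - c) * U b \<le> ln (Z c)" for b c
  proof -
    have "ln (Z b * exp ((b - c) * U b)) \<le> ln (Z c)"
      using gibbs_tangent[OF assms(1,2), of b a c] Zpos[of b] Zpos[of c]
      by (subst ln_le_cancel_iff) (auto simp: Z_def U_def)
    then show ?thesis using Zpos[of b] by (simp add: ln_mult)
  qed
  from tan[of b c] tan[of c b] have "(c - b) * (U c - U b) \<le> 0"
    by (simp add: algebra_simps)
  then have "U c \<le> U b"
    using \<open>b < c\<close> by (simp add: mult_le_0_iff)
  then have "b * (U c - U b) \<le> 0"
    using \<open>0 \<le> b\<close> by (simp add: mult_nonneg_nonpos)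
  with tan[of c b] have "ln (Z c) + c * U c \<le> ln (Z b) + b * U b"
    by (simp add: algebra_simps)
  then have "exp (ln (Z c) + c * U c) \<le> exp (ln (Z b) + b * U b)"
    by simp
  then show ?thesis
    using Zpos[of b] Zpos[of c] by (simp add: exp_add)
qed simp

text \<open>The perplexity with bandwidth \<open>s\<close> is the exponential Gibbs entropy for the energies
\<open>\<bar>x - X k\<bar>\<^sup>2 / 2\<close> at inverse temperature \<open>1 / s\<^sup>2\<close>.\<close>

lemma perplexity_mono:
  fixes x :: "'a::euclidean_space"
  assumes "n \<ge> 1" "0 < s" "s \<le> t"
  shows "perplexity X n x s \<le> perplexity X n x t"
proof -
  define a where "a k = (norm (x - X k))\<^sup>2 / 2" for k
  define Z where "Z b = (\<Sum>k=1..n. exp (- (b * a k)))" for b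
  define U where "U b = (\<Sum>k=1..n. a k * exp (- (b * a k))) / Z b" for b
  have e: "(norm (x - X k))\<^sup>2 / (2 * s\<^sup>2) = 1 / s\<^sup>2 * a k" for s k
    by (simp add: a_def)
  have pp: "perplexity X n x s = Z (1 / s\<^sup>2) * exp (1 / s\<^sup>2 * U (1 / s\<^sup>2))" for s
    unfolding perplexity_def e Z_def U_def
    by (simp only: sum_distrib_left mult.assoc times_divide_eq_right)
  have "1 / t\<^sup>2 \<le> 1 / s\<^sup>2"
    using assms by (intro divide_left_mono power_mono mult_pos_pos) auto
  then show ?thesis
    unfolding pp
    using gibbs_entropy_antimono[of "{1..n}" "1 / t\<^sup>2" "1 / s\<^sup>2" a] assms
    by (simp add: Z_def U_def)
qed

section \<open>Gaussian integrals\<close>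

lemma has_bochner_integral_lborel_prod:
  fixes f :: "'a::euclidean_space \<Rightarrow> real \<Rightarrow> real"
  assumes f: "\<And>b. b \<in> Basis \<Longrightarrow> has_bochner_integral lborel (f b) (c b)"
    and nn: "\<And>b x. b \<in> Basis \<Longrightarrow> 0 \<le> f b x"
  shows "has_bochner_integral lborel (\<lambda>x. \<Prod>b\<in>Basis. f b (x \<bullet> b)) (\<Prod>b\<in>Basis. c b)"
proof (rule has_bochner_integral_nn_integral)
  have meas [measurable]: "f b \<in> borel_measurable borel" if "b \<in> Basis" for b
    using f[OF that] by (auto simp: has_bochner_integral_iff)
  have c: "0 \<le> c b" "(\<integral>\<^sup>+x. f b x \<partial>lborel) = ennreal (c b)" if "b \<in> Basis" for b
    using f[OF that] nn[OF that] Bochner_Integration.integral_nonneg[of lborel "f b"]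
    by (auto simp: has_bochner_integral_iff nn_integral_eq_integral)
  show "(\<lambda>x. \<Prod>b\<in>Basis. f b (x \<bullet> b)) \<in> borel_measurable lborel"
    by measurable
  show "AE x in lborel. 0 \<le> (\<Prod>b\<in>Basis. f b (x \<bullet> b))"
    using nn by (auto intro!: prod_nonneg)
  show "0 \<le> (\<Prod>b\<in>Basis. c b)"
    using c by (auto intro!: prod_nonneg)
  have "(\<integral>\<^sup>+x. ennreal (\<Prod>b\<in>Basis. f b (x \<bullet> b)) \<partial>lborel) =
      (\<integral>\<^sup>+x. (\<Prod>b\<in>Basis. ennreal (f b (x \<bullet> b))) \<partial>lborel)"
    using nn by (simp add: prod_ennreal)
  also have "\<dots> = (\<Prod>b\<in>Basis. \<integral>\<^sup>+x. ennreal (f b x) \<partial>lborel)"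
    using nn by (intro nn_integral_lborel_prod) auto
  also have "\<dots> = ennreal (\<Prod>b\<in>Basis. c b)"
    using c by (simp add: prod_ennreal)
  finally show "(\<integral>\<^sup>+x. ennreal (\<Prod>b\<in>Basis. f b (x \<bullet> b)) \<partial>lborel) = ennreal (\<Prod>b\<in>Basis. c b)" .
qed

lemma gaussian_1d:
  "has_bochner_integral lborel (\<lambda>t::real. exp (- (t\<^sup>2 / 2))) (sqrt (2 * pi))"
  "has_bochner_integral lborel (\<lambda>t::real. t\<^sup>2 * exp (- (t\<^sup>2 / 2))) (sqrt (2 * pi))"
proof -
  have "has_bochner_integral lborel (\<lambda>x. sqrt (2 * pi) * (std_normal_density x * x ^ (2 * 0)))
      (sqrt (2 * pi) * (fact (2 * 0) / (2 ^ 0 * fact 0)))"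
    by (intro has_bochner_integral_mult_right std_normal_moment_even)
  then show "has_bochner_integral lborel (\<lambda>t::real. exp (- (t\<^sup>2 / 2))) (sqrt (2 * pi))"
    by (simp add: normal_density_def)
  have "has_bochner_integral lborel (\<lambda>x. sqrt (2 * pi) * (std_normal_density x * x ^ (2 * 1)))
      (sqrt (2 * pi) * (fact (2 * 1) / (2 ^ 1 * fact 1)))"
    by (intro has_bochner_integral_mult_right std_normal_moment_even)
  then show "has_bochner_integral lborel (\<lambda>t::real. t\<^sup>2 * exp (- (t\<^sup>2 / 2))) (sqrt (2 * pi))"
    by (simp add: normal_density_def mult.commute fact_2)
qed

lemma norm_power2_Basis: "(norm (x::'a::euclidean_space))\<^sup>2 = (\<Sum>b\<in>Basis. (x \<bullet> b)\<^sup>2)"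
  by (simp only: power2_norm_eq_inner euclidean_inner[of x x]) (simp add: power2_eq_square)

lemma exp_norm_prod_Basis:
  "exp (- ((norm (x::'a::euclidean_space))\<^sup>2 / 2)) = (\<Prod>b\<in>Basis. exp (- ((x \<bullet> b)\<^sup>2 / 2)))"
  by (simp add: norm_power2_Basis sum_negf[symmetric] sum_divide_distrib exp_sum)

lemma gaussian_integral:
  "has_bochner_integral lborel (\<lambda>x::'a::euclidean_space. exp (- ((norm x)\<^sup>2 / 2)))
     (sqrt (2 * pi) ^ DIM('a))"
  using has_bochner_integral_lborel_prod[of "\<lambda>_::'a. \<lambda>t. exp (- (t\<^sup>2 / 2))" "\<lambda>_. sqrt (2 * pi)"]
    gaussian_1d(1)
  by (simp add: exp_norm_prod_Basis)

text \<open>\<open>\<bar>x\<bar>\<^sup>2\<close> is the sum of the squared coordinates. Each summand turns the Gaussian into a product in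
which a single factor carries \<open>t\<^sup>2\<close>, and that factor still integrates to \<open>sqrt (2 * pi)\<close>.\<close>

lemma gaussian_second_moment:
  "has_bochner_integral lborel
     (\<lambda>x::'a::euclidean_space. (norm x)\<^sup>2 / 2 * exp (- ((norm x)\<^sup>2 / 2)))
     (real DIM('a) / 2 * sqrt (2 * pi) ^ DIM('a))"
proof -
  have one: "has_bochner_integral lborel (\<lambda>x::'a. (x \<bullet> i)\<^sup>2 * exp (- ((norm x)\<^sup>2 / 2)))
     (sqrt (2 * pi) ^ DIM('a))" if i: "i \<in> Basis" for i
  proof -
    have "has_bochner_integral lborel
        (\<lambda>x::'a. \<Prod>b\<in>Basis. (if b = i then (x \<bullet> b)\<^sup>2 else 1) * exp (- ((x \<bullet> b)\<^sup>2 / 2)))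
        (\<Prod>b\<in>(Basis::'a set). sqrt (2 * pi))"
    proof (rule has_bochner_integral_lborel_prod)
      show "has_bochner_integral lborel
          (\<lambda>t. (if b = i then t\<^sup>2 else 1) * exp (- (t\<^sup>2 / 2))) (sqrt (2 * pi))" for b
        using gaussian_1d by (cases "b = i") auto
    qed auto
    moreover have "(\<Prod>b\<in>Basis. if b = i then (x \<bullet> b)\<^sup>2 else 1) = (x \<bullet> i)\<^sup>2" for x :: 'a
      using i by simp
    ultimately show ?thesis
      by (simp add: prod.distrib exp_norm_prod_Basis)
  qed
  have "has_bochner_integral lborel
      (\<lambda>x::'a. (\<Sum>i\<in>Basis. (x \<bullet> i)\<^sup>2 * exp (- ((norm x)\<^sup>2 / 2))) / 2)
      ((\<Sum>i\<in>(Basis::'a set). sqrt (2 * pi) ^ DIM('a)) / 2)"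
    using one by (intro has_bochner_integral_divide_zero has_bochner_integral_sum) auto
  then show ?thesis
    by (simp add: sum_distrib_right[symmetric] norm_power2_Basis[symmetric])
qed

section \<open>Concentration of sums of bounded variables\<close>

lemma exp_le_quadratic:
  fixes l :: real
  assumes "\<bar>l\<bar> \<le> 1"
  shows "exp l \<le> 1 + l + l\<^sup>2"
proof (cases "l \<ge> 0")
  case True
  then show ?thesis using exp_bound[of l] assms by auto
next
  case False
  define u where "u = - l"
  have u: "0 < u" "u \<le> 1" using False assms by (auto simp: u_def)
  have "1 \<le> (1 + u) * (1 - u + u\<^sup>2)"
    using u by (simp add: algebra_simps power2_eq_square)
  also have "\<dots> \<le> exp u * (1 - u + u\<^sup>2)"
    using u by (intro mult_right_mono exp_ge_add_one_self) (auto intro: add_nonneg_nonneg)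
  finally have "exp (- u) \<le> 1 - u + u\<^sup>2"
    by (simp add: exp_minus field_simps)
  then show ?thesis by (simp add: u_def)
qed

text \<open>Convexity of the exponential reduces the moment generating function of a \<open>[0, 1]\<close>-valued variable to
its mean.\<close>

lemma exp_le_chord:
  fixes l y :: real
  assumes "0 \<le> y" "y \<le> 1"
  shows "exp (l * y) \<le> 1 + y * (exp l - 1)"
  using convex_onD[OF exp_convex, of y 0 l] assms by (simp add: algebra_simps)

text \<open>The exponent is governed by the mean, through \<open>q\<close>, as in Bernstein's inequality, and not by the
range of the variables as in Hoeffding's. This matters for kernels: the mean is of order \<open>h ^ d\<close>,
and an error of order \<open>h ^ d\<close> has to be excluded. The parameter \<open>l\<close> may have either
sign, so the statement covers both tails.\<close>

lemma (in prob_space) chernoff_one_sided: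
  fixes Y :: "'i \<Rightarrow> 'a \<Rightarrow> real" and p q l u :: real
  assumes I: "finite I" and indep: "indep_vars (\<lambda>_. borel) Y I"
    and Y: "\<And>i \<omega>. i \<in> I \<Longrightarrow> 0 \<le> Y i \<omega> \<and> Y i \<omega> \<le> 1"
    and p: "\<And>i. i \<in> I \<Longrightarrow> expectation (Y i) = p" and q: "0 \<le> p" "p \<le> q"
    and l: "\<bar>l\<bar> \<le> 1"
  shows "prob {\<omega> \<in> space M. u \<le> l * ((\<Sum>i\<in>I. Y i \<omega>) - card I * p)} \<le> exp (card I * q * l\<^sup>2 - u)"
proof -
  have meas [measurable]: "Y i \<in> borel_measurable M" if "i \<in> I" for i
    using indep that by (auto simp: indep_vars_def)
  have int: "integrable M (Y i)" if "i \<in> I" for i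
    using Y[OF that] that by (intro integrable_const_bound[where B=1]) auto
  have int_exp: "integrable M (\<lambda>\<omega>. exp (l * Y i \<omega>))" if "i \<in> I" for i
  proof (rule integrable_const_bound[where B="exp 1"])
    have "l * Y i \<omega> \<le> 1" for \<omega>
    proof -
      have "l * Y i \<omega> \<le> \<bar>l\<bar> * \<bar>Y i \<omega>\<bar>" by (simp add: abs_mult[symmetric])
      also have "\<dots> \<le> 1 * 1" using Y[OF that] l by (intro mult_mono) auto
      finally show ?thesis by simp
    qed
    then show "AE \<omega> in M. norm (exp (l * Y i \<omega>)) \<le> exp 1" by auto
  qed (use that in measurable)
  have mgf: "expectation (\<lambda>\<omega>. exp (l * Y i \<omega>)) \<le> exp (p * (l + l\<^sup>2))" if i: "i \<in> I" for i
  proof -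
    have "expectation (\<lambda>\<omega>. exp (l * Y i \<omega>)) \<le> expectation (\<lambda>\<omega>. 1 + Y i \<omega> * (exp l - 1))"
      using i Y by (intro integral_mono int_exp exp_le_chord) (auto intro!: int)
    also have "\<dots> = 1 + p * (exp l - 1)"
      using int[OF i] p[OF i] by (simp add: prob_space)
    also have "\<dots> \<le> 1 + p * (l + l\<^sup>2)"
      using exp_le_quadratic[OF l] q by (intro add_left_mono mult_left_mono) auto
    also have "\<dots> \<le> exp (p * (l + l\<^sup>2))"
      by (rule exp_ge_add_one_self)
    finally show ?thesis .
  qed
  have indep_exp: "indep_vars (\<lambda>_. borel) (\<lambda>i \<omega>. exp (l * Y i \<omega>)) I"
    using indep by (rule indep_vars_compose2) auto
  define S where "S \<omega> = (\<Sum>i\<in>I. Y i \<omega>)" for \<omega>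
  have [measurable]: "S \<in> borel_measurable M"
    unfolding S_def by measurable
  have expS: "exp (l * S \<omega>) = (\<Prod>i\<in>I. exp (l * Y i \<omega>))" for \<omega>
    by (simp add: S_def sum_distrib_left exp_sum[OF I])
  have intS: "integrable M (\<lambda>\<omega>. exp (l * S \<omega>))"
    unfolding expS using I indep_exp int_exp by (rule indep_vars_integrable)
  have "expectation (\<lambda>\<omega>. exp (l * S \<omega>)) = (\<Prod>i\<in>I. expectation (\<lambda>\<omega>. exp (l * Y i \<omega>)))"
    unfolding expS using I indep_exp int_exp by (rule indep_vars_lebesgue_integral)
  also have "\<dots> \<le> (\<Prod>i\<in>I. exp (p * (l + l\<^sup>2)))"
    using mgf by (intro prod_mono) (auto intro!: integral_nonneg)
  also have "\<dots> = exp (card I * p * (l + l\<^sup>2))"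
    by (simp add: exp_of_nat_mult[symmetric] mult.assoc)
  finally have E: "expectation (\<lambda>\<omega>. exp (l * S \<omega>)) \<le> exp (card I * p * (l + l\<^sup>2))" .
  have "prob {\<omega> \<in> space M. u \<le> l * (S \<omega> - card I * p)} =
      prob {\<omega> \<in> space M. exp (u + l * (card I * p)) \<le> exp (l * S \<omega>)}"
    by (intro arg_cong[where f=prob]) (auto simp: algebra_simps)
  also have "\<dots> \<le> expectation (\<lambda>\<omega>. exp (l * S \<omega>)) / exp (u + l * (card I * p))"
    using intS by (intro integral_Markov_inequality_measure[where A="{}"]) auto
  also have "\<dots> \<le> exp (card I * p * (l + l\<^sup>2)) / exp (u + l * (card I * p))"
    using E by (intro divide_right_mono) auto
  also have "\<dots> = exp (card I * p * l\<^sup>2 - u)"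
    by (simp add: exp_diff[symmetric] algebra_simps)
  also have "\<dots> \<le> exp (card I * q * l\<^sup>2 - u)"
    using q by (simp add: mult_left_mono mult_right_mono)
  finally show ?thesis by (simp add: S_def)
qed

lemma (in prob_space) chernoff_two_sided:
  fixes Y :: "'i \<Rightarrow> 'a \<Rightarrow> real" and p q l t :: real
  assumes I: "finite I" and indep: "indep_vars (\<lambda>_. borel) Y I"
    and Y: "\<And>i \<omega>. i \<in> I \<Longrightarrow> 0 \<le> Y i \<omega> \<and> Y i \<omega> \<le> 1"
    and p: "\<And>i. i \<in> I \<Longrightarrow> expectation (Y i) = p" and q: "0 \<le> p" "p \<le> q"
    and l: "0 < l" "l \<le> 1"
  shows "prob {\<omega> \<in> space M. t \<le> \<bar>(\<Sum>i\<in>I. Y i \<omega>) - card I * p\<bar>} \<le> 2 * exp (card I * q * l\<^sup>2 - l * t)"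
proof -
  have [measurable]: "Y i \<in> borel_measurable M" if "i \<in> I" for i
    using indep that by (auto simp: indep_vars_def)
  let ?D = "\<lambda>\<omega>. (\<Sum>i\<in>I. Y i \<omega>) - card I * p"
  have "prob {\<omega> \<in> space M. t \<le> \<bar>?D \<omega>\<bar>} \<le>
      prob ({\<omega> \<in> space M. l * t \<le> l * ?D \<omega>} \<union> {\<omega> \<in> space M. l * t \<le> - l * ?D \<omega>})"
  proof (intro finite_measure_mono subsetI)
    fix \<omega> assume "\<omega> \<in> {\<omega> \<in> space M. t \<le> \<bar>?D \<omega>\<bar>}"
    then have "\<omega> \<in> space M" "t \<le> ?D \<omega> \<or> t \<le> - ?D \<omega>" by auto
    then have "\<omega> \<in> space M" "l * t \<le> l * ?D \<omega> \<or> l * t \<le> - l * ?D \<omega>"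
      using l by (simp_all only: mult_le_cancel_left_pos mult_minus_left mult_minus_right[symmetric])
    then show "\<omega> \<in> {\<omega> \<in> space M. l * t \<le> l * ?D \<omega>} \<union> {\<omega> \<in> space M. l * t \<le> - l * ?D \<omega>}"
      by blast
  qed measurable
  also have "\<dots> \<le> prob {\<omega> \<in> space M. l * t \<le> l * ?D \<omega>} + prob {\<omega> \<in> space M. l * t \<le> - l * ?D \<omega>}"
    by (intro measure_Un_le) measurable
  also have "\<dots> \<le> exp (card I * q * l\<^sup>2 - l * t) + exp (card I * q * (- l)\<^sup>2 - l * t)"
    using l by (intro add_mono chernoff_one_sided[OF I indep Y p q]) auto
  finally show ?thesis by simp
qed

section \<open>Covering numbers of bounded sets\<close>

text \<open>The points are sorted into the cells of a cubic grid of side \<open>\<delta> / d\<close>, on which the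
\<open>l\<^sub>1\<close>-diameter, hence the Euclidean one, is at most \<open>\<delta>\<close>; one point of the set is kept from
every cell that it meets.\<close>

lemma bounded_covering_number:
  fixes K :: "'a::euclidean_space set"
  assumes "bounded K"
  shows "\<exists>D>0. \<forall>\<delta>\<in>{0<..1}. \<exists>N. finite N \<and> N \<subseteq> K \<and>
      real (card N) \<le> D / \<delta> ^ DIM('a) \<and> (\<forall>x\<in>K. \<exists>y\<in>N. dist x y \<le> \<delta>)"
proof -
  obtain R where R: "R > 0" "\<And>x. x \<in> K \<Longrightarrow> norm x \<le> R"
    using assms bounded_pos by blast
  let ?d = "real DIM('a)"
  have d: "?d \<ge> 1" using DIM_positive[where 'a='a] by linarith
  define D where "D = ((2 * R + 3) * ?d) ^ DIM('a)"
  show ?thesis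
  proof (intro exI[of _ D] conjI ballI)
    show "D > 0" unfolding D_def using R d by (intro zero_less_power mult_pos_pos) auto
    fix \<delta> :: real assume "\<delta> \<in> {0<..1}"
    then have \<delta>: "0 < \<delta>" "\<delta> \<le> 1" by auto
    define \<tau> where "\<tau> = \<delta> / ?d"
    have \<tau>: "0 < \<tau>" "\<tau> \<le> 1"
      using \<delta> d order_trans[OF \<delta>(2) d] by (simp_all add: \<tau>_def divide_le_eq_1 del: of_nat_le_iff)
    define m where "m = \<lceil>R / \<tau>\<rceil>"
    define cell where "cell x = restrict (\<lambda>b. \<lfloor>x \<bullet> b / \<tau>\<rfloor>) Basis" for x :: 'a
    define C where "C = (Basis::'a set) \<rightarrow>\<^sub>E {-m..m}"
    have "0 \<le> R / \<tau>" using R \<tau> by simp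
    then have m0: "m \<ge> 0" unfolding m_def by linarith
    have cellC: "cell ` K \<subseteq> C"
    proof safe
      fix x assume "x \<in> K"
      have "- m \<le> \<lfloor>x \<bullet> b / \<tau>\<rfloor> \<and> \<lfloor>x \<bullet> b / \<tau>\<rfloor> \<le> m" if "b \<in> Basis" for b
      proof -
        have "\<bar>x \<bullet> b\<bar> \<le> R" using Basis_le_norm[OF that, of x] R(2)[OF \<open>x \<in> K\<close>] by linarith
        then have "x \<bullet> b / \<tau> \<le> R / \<tau>" "- (R / \<tau>) \<le> x \<bullet> b / \<tau>"
          using \<tau> by (auto simp: divide_right_mono abs_le_iff field_simps)
        then show ?thesis unfolding m_def by linarith
      qed
      then show "cell x \<in> C" by (auto simp: C_def cell_def)
    qed
    have finC: "finite C" unfolding C_def by (intro finite_PiE) auto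
    define rep where "rep = inv_into K cell"
    define N where "N = rep ` cell ` K"
    have "card N \<le> card (cell ` K)"
      unfolding N_def using finC cellC by (intro card_image_le) (auto intro: finite_subset)
    also have "\<dots> \<le> card C" using finC cellC by (intro card_mono)
    also have "card C = nat (2 * m + 1) ^ DIM('a)"
      using m0 by (simp add: C_def card_PiE)
    finally have "real (card N) \<le> real (nat (2 * m + 1)) ^ DIM('a)"
      by (metis of_nat_le_iff of_nat_power)
    also have "real (nat (2 * m + 1)) = 2 * real_of_int m + 1"
      using m0 by simp
    also have "\<dots> ^ DIM('a) \<le> ((2 * R + 3) / \<tau>) ^ DIM('a)"
    proof (rule power_mono)
      have "real_of_int m \<le> R / \<tau> + 1" unfolding m_def by linarith
      then have "2 * real_of_int m + 1 \<le> 2 * (R / \<tau>) + 3" by linarith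
      also have "\<dots> \<le> (2 * R + 3) / \<tau>" using \<tau> by (simp add: field_simps)
      finally show "2 * real_of_int m + 1 \<le> (2 * R + 3) / \<tau>" .
      show "0 \<le> 2 * real_of_int m + 1" using m0 by simp
    qed
    also have "\<dots> = D / \<delta> ^ DIM('a)"
      using d by (simp add: \<tau>_def D_def power_divide)
    finally have card: "real (card N) \<le> D / \<delta> ^ DIM('a)" .
    have cov: "\<exists>y\<in>N. dist x y \<le> \<delta>" if "x \<in> K" for x
    proof
      show "rep (cell x) \<in> N" using that by (auto simp: N_def)
      have "cell (rep (cell x)) = cell x"
        unfolding rep_def using that by (intro f_inv_into_f) auto
      then have cell_b: "cell (rep (cell x)) b = cell x b" for b by simp
      have fl: "\<lfloor>rep (cell x) \<bullet> b / \<tau>\<rfloor> = \<lfloor>x \<bullet> b / \<tau>\<rfloor>" if "b \<in> Basis" for b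
        using cell_b[of b] that by (simp add: cell_def)
      have "\<bar>(x - rep (cell x)) \<bullet> b\<bar> \<le> \<tau>" if "b \<in> Basis" for b
      proof -
        have "\<bar>x \<bullet> b / \<tau> - rep (cell x) \<bullet> b / \<tau>\<bar> \<le> 1"
          using fl[OF that] by linarith
        then have "\<bar>(x \<bullet> b - rep (cell x) \<bullet> b) / \<tau>\<bar> \<le> 1"
          by (simp add: diff_divide_distrib)
        then show ?thesis using \<tau> by (simp add: inner_diff_left)
      qed
      then have "(\<Sum>b\<in>Basis. \<bar>(x - rep (cell x)) \<bullet> b\<bar>) \<le> ?d * \<tau>"
        by (rule sum_bounded_above)
      also have "\<dots> = \<delta>" using d by (simp add: \<tau>_def)
      finally show "dist x (rep (cell x)) \<le> \<delta>"
        using norm_le_l1[of "x - rep (cell x)"] by (simp add: dist_norm)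
    qed
    have "N \<subseteq> K"
      by (auto simp: N_def rep_def intro: inv_into_into)
    moreover have "finite N" unfolding N_def using finC cellC by (auto intro: finite_subset)
    ultimately show "\<exists>N. finite N \<and> N \<subseteq> K \<and> real (card N) \<le> D / \<delta> ^ DIM('a) \<and> (\<forall>x\<in>K. \<exists>y\<in>N. dist x y \<le> \<delta>)"
      using card cov by blast
  qed
qed

section \<open>Uniform concentration of kernel sums\<close>

text \<open>The growth condition says that a ball of radius \<open>h n\<close> contains many more than \<open>ln n\<close> sample
points; this is the threshold at which deviation probabilities beat every power of \<open>n\<close>.\<close>

definition admissible_bandwidth :: "nat \<Rightarrow> (nat \<Rightarrow> real) \<Rightarrow> bool" where
  "admissible_bandwidth d h \<longleftrightarrow> (\<forall>n\<ge>1. 0 < h n) \<and> h \<longlonglongrightarrow> 0 \<and>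
     filterlim (\<lambda>n. real n * h n ^ d / ln (real n)) at_top sequentially"

lemma admissible_bandwidth_scale:
  fixes h :: "nat \<Rightarrow> real"
  assumes "admissible_bandwidth d h" "s > 0"
  shows "admissible_bandwidth d (\<lambda>n. h n * s)"
proof -
  have "filterlim (\<lambda>n. s ^ d * (real n * h n ^ d / ln (real n))) at_top sequentially"
    using assms by (intro filterlim_tendsto_pos_mult_at_top[OF tendsto_const])
      (auto simp: admissible_bandwidth_def)
  moreover have "(\<lambda>n. h n * s) \<longlonglongrightarrow> 0 * s"
    using assms by (intro tendsto_intros) (auto simp: admissible_bandwidth_def)
  ultimately show ?thesis
    using assms by (simp add: admissible_bandwidth_def power_mult_distrib mult_ac)
qed

lemma admissible_bandwidth_log_le:
  fixes h :: "nat \<Rightarrow> real" and B :: real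
  assumes "admissible_bandwidth d h"
  shows "\<forall>\<^sub>F n in sequentially. B * ln (real n) \<le> real n * h n ^ d"
proof -
  have "\<forall>\<^sub>F n in sequentially. B \<le> real n * h n ^ d / ln (real n)"
    using assms by (auto simp: admissible_bandwidth_def filterlim_at_top)
  then show ?thesis
    using eventually_ge_at_top[of 2]
  proof eventually_elim
    case (elim n)
    then have "ln (real n) > 0" by simp
    then show ?case using elim(1) by (simp add: le_divide_eq)
  qed
qed

text \<open>At a single point the Chernoff bound makes a deviation of size \<open>\<epsilon> n h ^ d\<close> less likely than any
power of \<open>1 / n\<close>, because \<open>n h ^ d\<close> dominates \<open>ln n\<close>. Since the kernel is Lipschitz, moving the
point by a small multiple of \<open>h ^ (d + 1)\<close> changes every summand by a small multiple of \<open>h ^ d\<close>. A net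
with this spacing has polynomially many points in \<open>1 / h\<close>, hence in \<open>n\<close>, so a union bound over
the net is still summable and the Borel-Cantelli lemma applies.\<close>

lemma (in prob_space) uniform_kernel_concentration:
  fixes X :: "nat \<Rightarrow> 'a \<Rightarrow> 'b::euclidean_space" and \<phi> :: "'b \<Rightarrow> real"
    and h :: "nat \<Rightarrow> real" and L C \<epsilon> :: real
  assumes indep: "indep_vars (\<lambda>_. borel) X {1..}"
    and distr: "\<And>k. k \<ge> 1 \<Longrightarrow> distr M borel (X k) = \<mu>"
    and \<phi>: "\<And>u. 0 \<le> \<phi> u" "\<And>u. \<phi> u \<le> 1" and lip: "L-lipschitz_on UNIV \<phi>"
    and K: "bounded K" and h: "admissible_bandwidth DIM('b) h"
    and mean: "\<And>n x. n \<ge> 1 \<Longrightarrow> (\<integral>y. \<phi> ((x - y) /\<^sub>R h n) \<partial>\<mu>) \<le> C * h n ^ DIM('b)"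
    and \<epsilon>: "\<epsilon> > 0"
  shows "AE \<omega> in M. \<forall>\<^sub>F n in sequentially. \<forall>x\<in>K.
      \<bar>(\<Sum>k=1..n. \<phi> ((x - X k \<omega>) /\<^sub>R h n)) - n * (\<integral>y. \<phi> ((x - y) /\<^sub>R h n) \<partial>\<mu>)\<bar>
        \<le> \<epsilon> * (n * h n ^ DIM('b))"
proof -
  let ?d = "DIM('b)"
  have L: "L \<ge> 0" and lip': "\<And>u v. \<bar>\<phi> u - \<phi> v\<bar> \<le> L * dist u v"
    using lip by (auto simp: lipschitz_on_def dist_real_def)
  have [measurable]: "\<phi> \<in> borel_measurable borel"
    using lip by (intro borel_measurable_continuous_onI lipschitz_on_continuous_on)
  have X [measurable]: "X k \<in> borel_measurable M" if "k \<ge> 1" for k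
    using indep that by (auto simp: indep_vars_def)
  have sets_\<mu> [measurable_cong]: "sets \<mu> = sets borel"
    using distr[of 1] by auto
  have "prob_space (distr M borel (X 1))"
    by (intro prob_space_distr X) simp
  then have "prob_space \<mu>"
    by (simp only: distr[OF order_refl])
  then interpret \<mu>: prob_space \<mu> .
  have hpos: "h n > 0" if "n \<ge> 1" for n
    using h that by (auto simp: admissible_bandwidth_def)

  define S where "S n x \<omega> = (\<Sum>k=1..n. \<phi> ((x - X k \<omega>) /\<^sub>R h n))" for n x \<omega>
  define E where "E n x = (\<integral>y. \<phi> ((x - y) /\<^sub>R h n) \<partial>\<mu>)" for n x
  have int: "integrable \<mu> (\<lambda>y. \<phi> ((x - y) /\<^sub>R h n))" for n x
    using \<phi> by (intro \<mu>.integrable_const_bound[where B=1]) auto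
  have E0: "0 \<le> E n x" for n x
    unfolding E_def using \<phi> by (intro Bochner_Integration.integral_nonneg) auto

  define C' where "C' = max C 1"
  \<comment> \<open>\<open>l\<close> is the exponential tilt in the Chernoff bound. It is so small that the quadratic term
    \<open>C' * l\<^sup>2\<close> uses up at most half of the linear gain \<open>l * \<epsilon> / 2\<close>, and the rate \<open>c\<close> is what remains.\<close>
  define l where "l = min 1 (\<epsilon> / (4 * C'))"
  define c where "c = l * \<epsilon> / 4"
  have C': "C' \<ge> 1" "C \<le> C'" by (auto simp: C'_def)
  have l: "0 < l" "l \<le> 1" "l * C' \<le> \<epsilon> / 4"
  proof -
    show "0 < l" "l \<le> 1" using \<epsilon> C' by (auto simp: l_def)
    have "l * C' \<le> \<epsilon> / (4 * C') * C'" unfolding l_def using C' by (intro mult_right_mono) auto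
    then show "l * C' \<le> \<epsilon> / 4" using C' by simp
  qed
  have c: "c > 0" using l \<epsilon> by (simp add: c_def)

  have tail: "prob {\<omega> \<in> space M. \<epsilon> / 2 * (n * h n ^ ?d) \<le> \<bar>S n x \<omega> - n * E n x\<bar>}
      \<le> 2 * exp (- c * (n * h n ^ ?d))" if n: "n \<ge> 1" for n x
  proof -
    have "prob {\<omega> \<in> space M. \<epsilon> / 2 * (n * h n ^ ?d) \<le>
        \<bar>(\<Sum>k\<in>{1..n}. \<phi> ((x - X k \<omega>) /\<^sub>R h n)) - card {1..n} * E n x\<bar>}
      \<le> 2 * exp (card {1..n} * (C' * h n ^ ?d) * l\<^sup>2 - l * (\<epsilon> / 2 * (n * h n ^ ?d)))"
    proof (rule chernoff_two_sided)
      show "indep_vars (\<lambda>_. borel) (\<lambda>k \<omega>. \<phi> ((x - X k \<omega>) /\<^sub>R h n)) {1..n}"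
        using indep_vars_subset[OF indep, of "{1..n}"]
        by (rule indep_vars_compose2[where Y="\<lambda>_ y. \<phi> ((x - y) /\<^sub>R h n)"]) auto
      show "expectation (\<lambda>\<omega>. \<phi> ((x - X k \<omega>) /\<^sub>R h n)) = E n x" if "k \<in> {1..n}" for k
        using that X[of k] by (simp add: E_def distr[symmetric, of k] integral_distr)
      have "E n x \<le> C * h n ^ ?d" using mean[OF n] by (simp add: E_def)
      also have "\<dots> \<le> C' * h n ^ ?d" using C' hpos[OF n] by (intro mult_right_mono) auto
      finally show "E n x \<le> C' * h n ^ ?d" .
    qed (use \<phi> l E0 in auto)
    also have "\<dots> \<le> 2 * exp (- c * (n * h n ^ ?d))"
    proof -
      have "l * C' * (l * (n * h n ^ ?d)) \<le> \<epsilon> / 4 * (l * (n * h n ^ ?d))"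
        using l hpos[OF n] by (intro mult_right_mono) auto
      then show ?thesis by (simp add: c_def power2_eq_square algebra_simps)
    qed
    finally show ?thesis by (simp add: S_def)
  qed

  \<comment> \<open>Half of \<open>\<epsilon>\<close> is allowed for the deviation on the net; passing to the nearest net point costs
    another quarter in the sum and a quarter in the mean.\<close>
  define \<eta> where "\<eta> = \<epsilon> / (4 * (L + 1))"
  define \<delta> where "\<delta> n = \<eta> * h n ^ (?d + 1)" for n
  have \<eta>: "\<eta> > 0" "L * \<eta> \<le> \<epsilon> / 4"
    using \<epsilon> L by (auto simp: \<eta>_def field_simps intro: add_nonneg_pos)
  have \<delta>0: "\<delta> n > 0" if "n \<ge> 1" for n using \<eta> hpos[OF that] by (simp add: \<delta>_def)
  have "(\<lambda>n. \<eta> * h n ^ (?d + 1)) \<longlonglongrightarrow> \<eta> * 0 ^ (?d + 1)"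
    using h by (intro tendsto_intros) (auto simp: admissible_bandwidth_def)
  then have "\<delta> \<longlonglongrightarrow> 0" by (simp add: \<delta>_def [abs_def])
  then have "\<forall>\<^sub>F n in sequentially. \<delta> n < 1"
    by (rule order_tendstoD) simp
  then have \<delta>1: "\<forall>\<^sub>F n in sequentially. n \<ge> 1 \<and> \<delta> n \<le> 1"
    using eventually_ge_at_top[of 1] by eventually_elim auto
  obtain D where D: "D > 0" "\<forall>\<delta>\<in>{0<..1}. \<exists>N. finite N \<and> N \<subseteq> K \<and>
      real (card N) \<le> D / \<delta> ^ ?d \<and> (\<forall>x\<in>K. \<exists>y\<in>N. dist x y \<le> \<delta>)"
    using bounded_covering_number[OF K] by (elim exE conjE)
  have "\<exists>N. finite N \<and> (n \<ge> 1 \<and> \<delta> n \<le> 1 \<longrightarrow>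
      real (card N) \<le> D / \<delta> n ^ ?d \<and> (\<forall>x\<in>K. \<exists>y\<in>N. dist x y \<le> \<delta> n))" for n
  proof (cases "n \<ge> 1 \<and> \<delta> n \<le> 1")
    case True
    then have "\<delta> n \<in> {0<..1}" using \<delta>0 by auto
    then show ?thesis using D(2) by (elim ballE[where x="\<delta> n"]) auto
  qed auto
  then obtain N where N': "\<And>n. finite (N n) \<and> (n \<ge> 1 \<and> \<delta> n \<le> 1 \<longrightarrow>
      real (card (N n)) \<le> D / \<delta> n ^ ?d \<and> (\<forall>x\<in>K. \<exists>y\<in>N n. dist x y \<le> \<delta> n))"
    using choice[of "\<lambda>n N. finite N \<and> (n \<ge> 1 \<and> \<delta> n \<le> 1 \<longrightarrow>
      real (card N) \<le> D / \<delta> n ^ ?d \<and> (\<forall>x\<in>K. \<exists>y\<in>N. dist x y \<le> \<delta> n))"] by blast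
  have N: "finite (N n)" "n \<ge> 1 \<Longrightarrow> \<delta> n \<le> 1 \<Longrightarrow> real (card (N n)) \<le> D / \<delta> n ^ ?d"
      "n \<ge> 1 \<Longrightarrow> \<delta> n \<le> 1 \<Longrightarrow> x \<in> K \<Longrightarrow> \<exists>y\<in>N n. dist x y \<le> \<delta> n" for n x
    using N'[of n] by auto

  define Bad where "Bad n = (\<Union>y\<in>N n. {\<omega> \<in> space M. \<epsilon> / 2 * (n * h n ^ ?d) \<le> \<bar>S n y \<omega> - n * E n y\<bar>})" for n
  have S_meas [measurable]: "S n x \<in> borel_measurable M" for n x
    unfolding S_def by measurable
  have Bad_sets [measurable]: "Bad n \<in> sets M" for n
    unfolding Bad_def using N(1) by (intro sets.finite_UN) auto
  \<comment> \<open>The net has \<open>O(n ^ (d + 1))\<close> points and each is bad with probability \<open>O(n ^ -(d + 3))\<close>; the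
    instance \<open>1 / ln 2\<close> of the growth condition only serves to give \<open>n * h n ^ d \<ge> 1\<close>.\<close>
  have "\<forall>\<^sub>F n in sequentially. norm (prob (Bad n)) \<le> 2 * D / \<eta> ^ ?d * inverse (real n ^ 2)"
    using \<delta>1 admissible_bandwidth_log_le[OF h, of "(?d + 3) / c"]
      admissible_bandwidth_log_le[OF h, of "1 / ln 2"] eventually_ge_at_top[of 2]
  proof eventually_elim
    case (elim n)
    then have n: "n \<ge> 1" "\<delta> n \<le> 1" "n \<ge> 2" by auto
    define w where "w = h n ^ ?d"
    have w: "w > 0" using hpos[OF n(1)] by (simp add: w_def)
    have "1 \<le> 1 / ln 2 * ln (real n)" using n(3) by simp
    also have "\<dots> \<le> n * w" using elim(3) by (simp add: w_def)
    finally have "1 / w \<le> n" using w by (simp add: field_simps)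
    then have w_le: "(1 / w) ^ (?d + 1) \<le> real n ^ (?d + 1)"
      using w by (intro power_mono) auto
    have "\<delta> n ^ ?d = \<eta> ^ ?d * w ^ (?d + 1)"
      by (simp only: \<delta>_def w_def power_mult_distrib power_mult[symmetric] mult.commute)
    then have card: "card (N n) \<le> D / \<eta> ^ ?d * (1 / w) ^ (?d + 1)"
      using N(2)[OF n(1,2)] by (simp add: field_simps)
    have "(?d + 3) * ln (real n) \<le> c * (n * w)"
      using elim(2) c by (simp add: w_def field_simps)
    then have "exp (- c * (n * w)) \<le> exp (- ((?d + 3) * ln (real n)))" by simp
    also have "\<dots> = inverse (real n ^ (?d + 3))"
    proof -
      have "exp (real (?d + 3) * ln (real n)) = real n ^ (?d + 3)"
        using n by (subst exp_of_nat_mult) simp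
      then show ?thesis by (simp only: exp_minus)
    qed
    finally have ex: "exp (- c * (n * w)) \<le> inverse (real n ^ (?d + 3))" .
    have "prob (Bad n) \<le> (\<Sum>y\<in>N n. prob {\<omega> \<in> space M. \<epsilon> / 2 * (n * h n ^ ?d) \<le> \<bar>S n y \<omega> - n * E n y\<bar>})"
      unfolding Bad_def using N(1) by (intro finite_measure_subadditive_finite) auto
    also have "\<dots> \<le> (\<Sum>y\<in>N n. 2 * exp (- c * (n * w)))"
      unfolding w_def using n by (intro sum_mono tail) auto
    also have "\<dots> = card (N n) * (2 * exp (- c * (n * w)))" by simp
    also have "\<dots> \<le> (D / \<eta> ^ ?d * (1 / w) ^ (?d + 1)) * (2 * inverse (real n ^ (?d + 3)))"
      using card ex D \<eta> w by (intro mult_mono) auto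
    also have "\<dots> \<le> (D / \<eta> ^ ?d * real n ^ (?d + 1)) * (2 * inverse (real n ^ (?d + 3)))"
      using w_le D \<eta> by (intro mult_right_mono mult_left_mono) auto
    also have "\<dots> = 2 * D / \<eta> ^ ?d * inverse (real n ^ 2)"
      using n by (simp add: field_simps power_add eval_nat_numeral)
    finally show ?case by simp
  qed
  moreover have "summable (\<lambda>n. 2 * D / \<eta> ^ ?d * inverse (real n ^ 2))"
    by (intro summable_mult inverse_power_summable) auto
  ultimately have "summable (\<lambda>n. prob (Bad n))"
    by (rule summable_comparison_test_ev)
  then have "AE \<omega> in M. \<forall>\<^sub>F n in sequentially. \<omega> \<in> space M - Bad n"
    by (intro borel_cantelli_AE1) (auto simp: emeasure_eq_measure)
  then show ?thesis
  proof eventually_elim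
    case (elim \<omega>)
    show ?case
      using elim \<delta>1
    proof eventually_elim
      case (elim n)
      then have n: "n \<ge> 1" "\<delta> n \<le> 1" and \<omega>: "\<omega> \<in> space M" "\<omega> \<notin> Bad n" by auto
      show ?case
      proof
        fix x assume "x \<in> K"
        then obtain y where y: "y \<in> N n" "dist x y \<le> \<delta> n"
          using N(3) n by blast
        define b where "b = \<epsilon> / 4 * h n ^ ?d"
        have close: "\<bar>\<phi> ((x - z) /\<^sub>R h n) - \<phi> ((y - z) /\<^sub>R h n)\<bar> \<le> b" for z
        proof -
          have "dist ((x - z) /\<^sub>R h n) ((y - z) /\<^sub>R h n) = dist x y / h n"
            using hpos[OF n(1)] by (simp add: dist_norm scaleR_diff_right[symmetric] divide_inverse)
          also have "\<dots> \<le> \<eta> * h n ^ ?d"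
            using y hpos[OF n(1)] by (simp add: \<delta>_def divide_le_eq mult_ac)
          finally have "L * dist ((x - z) /\<^sub>R h n) ((y - z) /\<^sub>R h n) \<le> L * (\<eta> * h n ^ ?d)"
            using L by (rule mult_left_mono)
          also have "\<dots> \<le> b"
            unfolding b_def mult.assoc[symmetric] using \<eta> hpos[OF n(1)] by (intro mult_right_mono) auto
          finally show ?thesis using lip' order_trans by blast
        qed
        have "\<bar>S n x \<omega> - S n y \<omega>\<bar> \<le> (\<Sum>k=1..n. \<bar>\<phi> ((x - X k \<omega>) /\<^sub>R h n) - \<phi> ((y - X k \<omega>) /\<^sub>R h n)\<bar>)"
          unfolding S_def sum_subtractf[symmetric] by (rule sum_abs)
        also have "\<dots> \<le> n * b" using sum_bounded_above[of "{1..n}", OF close] by simp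
        finally have 1: "\<bar>S n x \<omega> - S n y \<omega>\<bar> \<le> n * b" .
        have "\<bar>E n x - E n y\<bar> \<le> (\<integral>z. \<bar>\<phi> ((x - z) /\<^sub>R h n) - \<phi> ((y - z) /\<^sub>R h n)\<bar> \<partial>\<mu>)"
          unfolding E_def by (subst Bochner_Integration.integral_diff[symmetric, OF int int]) (rule integral_abs_bound)
        also have "\<dots> \<le> (\<integral>z. b \<partial>\<mu>)"
          using close by (intro integral_mono) (auto intro!: int)
        finally have "\<bar>E n x - E n y\<bar> \<le> b" by (simp add: \<mu>.prob_space)
        then have "n * \<bar>E n x - E n y\<bar> \<le> n * b" by (intro mult_left_mono) auto
        then have 2: "\<bar>n * E n x - n * E n y\<bar> \<le> n * b"
          by (simp add: abs_mult right_diff_distrib[symmetric])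
        have 3: "\<bar>S n y \<omega> - n * E n y\<bar> < \<epsilon> / 2 * (n * h n ^ ?d)"
          using y \<omega> by (auto simp: Bad_def not_le)
        have "n * b = \<epsilon> / 4 * (n * h n ^ ?d)" by (simp add: b_def)
        with 1 2 3 have "\<bar>S n x \<omega> - n * E n x\<bar> \<le> \<epsilon> * (n * h n ^ ?d)" by linarith
        then show "\<bar>(\<Sum>k=1..n. \<phi> ((x - X k \<omega>) /\<^sub>R h n)) - n * (\<integral>y. \<phi> ((x - y) /\<^sub>R h n) \<partial>\<mu>)\<bar>
            \<le> \<epsilon> * (n * h n ^ ?d)"
          by (simp add: S_def E_def)
      qed
    qed
  qed
qed

section \<open>The expected kernel sum\<close>

text \<open>Limits along \<open>sequentially \<times>\<^sub>F principal K\<close> express convergence that is uniform on \<open>K\<close>. For a limit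
that is constant in the point of \<open>K\<close>, all rules for products, quotients and exponentials of limits
become available.\<close>

lemma eventually_prod_principal_iff:
  "eventually P (F \<times>\<^sub>F principal K) \<longleftrightarrow> eventually (\<lambda>n. \<forall>x\<in>K. P (n, x)) F"
  unfolding eventually_prod_filter eventually_principal
proof safe
  assume "\<forall>\<^sub>F n in F. \<forall>x\<in>K. P (n, x)"
  then show "\<exists>Pf Pg. eventually Pf F \<and> (\<forall>x\<in>K. Pg x) \<and> (\<forall>x y. Pf x \<longrightarrow> Pg y \<longrightarrow> P (x, y))"
    by (intro exI[of _ "\<lambda>n. \<forall>x\<in>K. P (n, x)"] exI[of _ "\<lambda>x. x \<in> K"]) auto
qed (auto elim: eventually_mono)

text \<open>If uniformity failed, a sequence of points violating it would contradict the hypothesis. This reduces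
uniform statements about integrals to dominated convergence.\<close>

lemma tendsto_uniformly_if_sequences:
  fixes f :: "nat \<Rightarrow> 'a \<Rightarrow> 'b::metric_space"
  assumes "\<And>y. (\<And>n. y n \<in> K) \<Longrightarrow> (\<lambda>n. f n (y n)) \<longlonglongrightarrow> c"
  shows "((\<lambda>(n, x). f n x) \<longlongrightarrow> c) (sequentially \<times>\<^sub>F principal K)"
proof (rule tendstoI)
  fix e :: real assume e: "e > 0"
  have "\<forall>\<^sub>F n in sequentially. \<forall>x\<in>K. dist (f n x) c < e"
  proof (cases "K = {}")
    case False
    define y where "y n = (SOME x. x \<in> K \<and> ((\<exists>x\<in>K. \<not> dist (f n x) c < e) \<longrightarrow> \<not> dist (f n x) c < e))" for n
    have y: "y n \<in> K \<and> ((\<exists>x\<in>K. \<not> dist (f n x) c < e) \<longrightarrow> \<not> dist (f n (y n)) c < e)" for n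
      unfolding y_def by (rule someI_ex) (use False in blast)
    then have "(\<lambda>n. f n (y n)) \<longlonglongrightarrow> c" by (intro assms) auto
    then have "\<forall>\<^sub>F n in sequentially. dist (f n (y n)) c < e" using e by (rule tendstoD)
    then show ?thesis by eventually_elim (use y in blast)
  qed auto
  then show "\<forall>\<^sub>F p in sequentially \<times>\<^sub>F principal K. dist (case p of (n, x) \<Rightarrow> f n x) c < e"
    by (simp add: eventually_prod_principal_iff)
qed

lemma integral_lborel_affine:
  fixes F :: "'a::euclidean_space \<Rightarrow> real"
  assumes "c \<noteq> 0" and [measurable]: "F \<in> borel_measurable borel"
  shows "(\<integral>y. F y \<partial>lborel) = \<bar>c\<bar> ^ DIM('a) * (\<integral>u. F (t + c *\<^sub>R u) \<partial>lborel)"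
  by (subst lborel_affine[OF assms(1), of t]) (simp add: integral_density integral_distr)

locale bounded_density =
  fixes \<Omega> :: "'a::euclidean_space set" and \<rho> :: "'a \<Rightarrow> real" and R :: real and \<mu> :: "'a measure"
  assumes open_domain: "open \<Omega>"
    and unif: "uniformly_continuous_on \<Omega> \<rho>"
    and R_pos: "R > 0"
    and bounds: "\<And>x. x \<in> \<Omega> \<Longrightarrow> 1 / R < \<rho> x \<and> \<rho> x < R"
    and law: "\<mu> = density lborel (\<lambda>x. ennreal (\<rho> x) * indicator \<Omega> x)"
begin

text \<open>Extension by zero makes the law a density on the whole space, so that the change of variables needs no
case distinction at the boundary.\<close>

definition ext_density :: "'a \<Rightarrow> real" where "ext_density x = indicator \<Omega> x * \<rho> x"

lemma rho_pos: "x \<in> \<Omega> \<Longrightarrow> 0 < \<rho> x"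
  using bounds[of x] R_pos by (meson less_trans zero_less_divide_1_iff)

lemma ext_density_measurable [measurable]: "ext_density \<in> borel_measurable borel"
  unfolding ext_density_def
  using borel_measurable_continuous_on_indicator[OF _ uniformly_continuous_imp_continuous[OF unif]] open_domain
  by simp

lemma ext_density_bounds: "0 \<le> ext_density x" "ext_density x \<le> R"
  using rho_pos[of x] bounds[of x] R_pos by (auto simp: ext_density_def indicator_def)

lemma law_ext_density: "\<mu> = density lborel ext_density"
  unfolding law ext_density_def by (intro arg_cong[where f="density lborel"]) (auto simp: indicator_def)

text \<open>Substitution of \<open>y = x - h u\<close>.\<close>

lemma integral_kernel:
  assumes [measurable]: "\<phi> \<in> borel_measurable borel" and "h > 0"
  shows "(\<integral>y. \<phi> ((x - y) /\<^sub>R h) \<partial>\<mu>) = h ^ DIM('a) * (\<integral>u. \<phi> u * ext_density (x - h *\<^sub>R u) \<partial>lborel)"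
proof -
  have "(\<integral>y. \<phi> ((x - y) /\<^sub>R h) \<partial>\<mu>) = (\<integral>y. ext_density y * \<phi> ((x - y) /\<^sub>R h) \<partial>lborel)"
    unfolding law_ext_density using ext_density_bounds by (subst integral_density) auto
  also have "\<dots> = h ^ DIM('a) * (\<integral>u. ext_density (x + (- h) *\<^sub>R u) * \<phi> ((x - (x + (- h) *\<^sub>R u)) /\<^sub>R h) \<partial>lborel)"
    using \<open>h > 0\<close> by (subst integral_lborel_affine[of "- h" _ x]) auto
  finally show ?thesis using \<open>h > 0\<close> by (simp add: mult.commute)
qed

lemma integral_kernel_le:
  assumes \<phi>: "integrable lborel \<phi>" "\<And>u. 0 \<le> \<phi> u" and "h > 0"
  shows "(\<integral>y. \<phi> ((x - y) /\<^sub>R h) \<partial>\<mu>) \<le> R * (\<integral>u. \<phi> u \<partial>lborel) * h ^ DIM('a)"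
proof -
  have [measurable]: "\<phi> \<in> borel_measurable borel" using \<phi>(1) by auto
  have le: "\<phi> u * ext_density (x - h *\<^sub>R u) \<le> \<phi> u * R" for u
    using \<phi> ext_density_bounds by (intro mult_left_mono) auto
  have "(\<integral>u. \<phi> u * ext_density (x - h *\<^sub>R u) \<partial>lborel) \<le> (\<integral>u. \<phi> u * R \<partial>lborel)"
  proof (rule integral_mono)
    show "integrable lborel (\<lambda>u. \<phi> u * ext_density (x - h *\<^sub>R u))"
      by (rule Bochner_Integration.integrable_bound[where f="\<lambda>u. \<phi> u * R"])
        (use \<phi> ext_density_bounds le R_pos in \<open>auto simp: abs_mult\<close>)
  qed (use \<phi> le in auto)
  then have "h ^ DIM('a) * (\<integral>u. \<phi> u * ext_density (x - h *\<^sub>R u) \<partial>lborel) \<le> h ^ DIM('a) * ((\<integral>u. \<phi> u \<partial>lborel) * R)"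
    using \<open>h > 0\<close> by (intro mult_left_mono) auto
  then show ?thesis
    using \<open>h > 0\<close> by (simp add: integral_kernel mult_ac)
qed

text \<open>After substitution the quotient is the integral of \<open>\<phi> u * ext_density (x - h u) / \<rho> x\<close>. A compact
subset of the domain keeps a positive distance from the complement, so for fixed \<open>u\<close> the point
\<open>x - h u\<close> eventually lies in the domain, uniformly in \<open>x\<close>, and uniform continuity drives the
ratio of densities to \<open>1\<close>. Dividing by \<open>\<rho> x\<close> makes the limit constant in \<open>x\<close>.\<close>

lemma kernel_mean_tendsto:
  assumes \<phi>: "integrable lborel \<phi>" "\<And>u. 0 \<le> \<phi> u"
    and K: "compact K" "K \<subseteq> \<Omega>"
    and h: "h \<longlonglongrightarrow> 0" "\<And>n. n \<ge> 1 \<Longrightarrow> 0 < h n"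
  shows "((\<lambda>(n, x). (\<integral>y. \<phi> ((x - y) /\<^sub>R h n) \<partial>\<mu>) / (h n ^ DIM('a) * \<rho> x)) \<longlongrightarrow> (\<integral>u. \<phi> u \<partial>lborel))
    (sequentially \<times>\<^sub>F principal K)"
proof (rule tendsto_uniformly_if_sequences)
  fix y assume y: "y n \<in> K" for n :: nat
  have [measurable]: "\<phi> \<in> borel_measurable borel" using \<phi>(1) by auto
  have y\<Omega>: "y n \<in> \<Omega>" for n using y K by auto
  obtain e where e: "e > 0" "(\<Union>x\<in>K. ball x e) \<subseteq> \<Omega>"
    using compact_subset_open_imp_ball_epsilon_subset[OF K(1) open_domain K(2)] by blast
  have ratio: "(\<lambda>n. ext_density (y n - h n *\<^sub>R u) / \<rho> (y n)) \<longlonglongrightarrow> 1" for u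
  proof -
    have hu: "(\<lambda>n. h n *\<^sub>R u) \<longlonglongrightarrow> 0"
      using tendsto_scaleR[OF h(1) tendsto_const[of u]] by simp
    show ?thesis
    proof (rule tendstoI)
      fix r :: real assume "r > 0"
      then have "r / R > 0" using R_pos by simp
      then obtain d where d: "d > 0"
        "\<And>x x'. x \<in> \<Omega> \<Longrightarrow> x' \<in> \<Omega> \<Longrightarrow> dist x' x < d \<Longrightarrow> dist (\<rho> x') (\<rho> x) < r / R"
        using unif unfolding uniformly_continuous_on_def by metis
      have "\<forall>\<^sub>F n in sequentially. dist (h n *\<^sub>R u) 0 < min d e"
        using tendstoD[OF hu, of "min d e"] d e by simp
      then show "\<forall>\<^sub>F n in sequentially. dist (ext_density (y n - h n *\<^sub>R u) / \<rho> (y n)) 1 < r"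
      proof eventually_elim
        case (elim n)
        then have near: "dist (y n) (y n - h n *\<^sub>R u) < e" "dist (y n - h n *\<^sub>R u) (y n) < d"
          by (auto simp: dist_norm)
        then have "y n - h n *\<^sub>R u \<in> (\<Union>x\<in>K. ball x e)"
          using near(1) y[of n] by (intro UN_I[of "y n"]) (simp_all only: mem_ball)
        then have in_dom: "y n - h n *\<^sub>R u \<in> \<Omega>" using e(2) by blast
        have \<rho>: "\<rho> (y n) > 0" "1 / \<rho> (y n) \<le> R"
          using bounds[OF y\<Omega>[of n]] rho_pos[OF y\<Omega>[of n]] R_pos by (auto simp: field_simps)
        have "dist (ext_density (y n - h n *\<^sub>R u) / \<rho> (y n)) 1 = \<bar>\<rho> (y n - h n *\<^sub>R u) - \<rho> (y n)\<bar> * (1 / \<rho> (y n))"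
          using \<rho> in_dom by (simp add: ext_density_def dist_real_def field_simps abs_divide[symmetric])
        also have "\<dots> \<le> \<bar>\<rho> (y n - h n *\<^sub>R u) - \<rho> (y n)\<bar> * R"
          using \<rho> by (intro mult_left_mono) auto
        also have "\<dots> < r"
          using d(2)[OF y\<Omega> in_dom near(2)] R_pos by (simp add: dist_real_def field_simps)
        finally show ?case .
      qed
    qed
  qed
  have "(\<lambda>n. \<integral>u. \<phi> u * (ext_density (y n - h n *\<^sub>R u) / \<rho> (y n)) \<partial>lborel) \<longlonglongrightarrow> (\<integral>u. \<phi> u * 1 \<partial>lborel)"
  proof (rule integral_dominated_convergence[where w="\<lambda>u. \<phi> u * (R * R)"])
    show "AE u in lborel. (\<lambda>n. \<phi> u * (ext_density (y n - h n *\<^sub>R u) / \<rho> (y n))) \<longlonglongrightarrow> \<phi> u * 1"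
      using ratio by (intro AE_I2 tendsto_mult tendsto_const) auto
    show "AE u in lborel. norm (\<phi> u * (ext_density (y n - h n *\<^sub>R u) / \<rho> (y n))) \<le> \<phi> u * (R * R)" for n
    proof (intro AE_I2)
      fix u
      have "1 / \<rho> (y n) \<le> R"
        using bounds[OF y\<Omega>[of n]] rho_pos[OF y\<Omega>[of n]] R_pos by (simp add: field_simps)
      then have "ext_density (y n - h n *\<^sub>R u) * (1 / \<rho> (y n)) \<le> R * R"
        using ext_density_bounds R_pos rho_pos[OF y\<Omega>[of n]] by (intro mult_mono) (auto intro: less_imp_le)
      then have "\<phi> u * (ext_density (y n - h n *\<^sub>R u) * (1 / \<rho> (y n))) \<le> \<phi> u * (R * R)"
        using \<phi>(2)[of u] by (rule mult_left_mono)
      then show "norm (\<phi> u * (ext_density (y n - h n *\<^sub>R u) / \<rho> (y n))) \<le> \<phi> u * (R * R)"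
        using \<phi>(2)[of u] ext_density_bounds(1) rho_pos[OF y\<Omega>[of n]] by (simp add: abs_mult)
    qed
    show "integrable lborel (\<lambda>u. \<phi> u * (R * R))" using \<phi> by auto
  qed auto
  moreover have "\<forall>\<^sub>F n in sequentially. (\<integral>u. \<phi> u * (ext_density (y n - h n *\<^sub>R u) / \<rho> (y n)) \<partial>lborel) =
      (\<integral>z. \<phi> ((y n - z) /\<^sub>R h n) \<partial>\<mu>) / (h n ^ DIM('a) * \<rho> (y n))"
    using eventually_ge_at_top[of 1]
  proof eventually_elim
    case (elim n)
    then show ?case
      using h(2)[OF elim] by (simp add: integral_kernel)
  qed
  ultimately show "(\<lambda>n. (\<integral>z. \<phi> ((y n - z) /\<^sub>R h n) \<partial>\<mu>) / (h n ^ DIM('a) * \<rho> (y n))) \<longlonglongrightarrow> (\<integral>u. \<phi> u \<partial>lborel)"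
    by (simp add: tendsto_cong)
qed

end

section \<open>The two Gaussian kernels\<close>

text \<open>The norm is 1-Lipschitz, so the mean value theorem on the real line suffices.\<close>

lemma lipschitz_radial:
  fixes f :: "real \<Rightarrow> real"
  assumes "\<And>r. (f has_real_derivative f' r) (at r)" "\<And>r. \<bar>f' r\<bar> \<le> L"
  shows "L-lipschitz_on UNIV (\<lambda>u::'a::real_normed_vector. f (norm u))"
proof (rule lipschitz_onI)
  have "0 \<le> \<bar>f' 0\<bar>" by simp
  then show L: "0 \<le> L" using assms(2) order_trans by blast
  fix u v :: 'a
  have "norm (f (norm u) - f (norm v)) \<le> L * norm (norm u - norm v)"
    by (rule field_differentiable_bound[of UNIV f f']) (use assms in auto)
  also have "\<dots> \<le> L * norm (u - v)"
    using L norm_triangle_ineq3[of u v] by (intro mult_left_mono) auto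
  finally show "dist (f (norm u)) (f (norm v)) \<le> L * dist u v"
    by (simp add: dist_norm)
qed

lemma abs_le_exp_square: "\<bar>r\<bar> \<le> exp (r\<^sup>2 / 4)" for r :: real
proof -
  have "0 \<le> (1 - \<bar>r\<bar> / 2)\<^sup>2" by simp
  then have "\<bar>r\<bar> \<le> 1 + r\<^sup>2 / 4" by (simp add: power2_eq_square algebra_simps)
  also have "\<dots> \<le> exp (r\<^sup>2 / 4)" by (rule exp_ge_add_one_self)
  finally show ?thesis .
qed

lemma mult_exp_minus_le:
  fixes a c t :: real
  assumes "a \<le> c * exp t"
  shows "a * exp (- t) \<le> c"
  using mult_right_mono[OF assms, of "exp (- t)"] by (simp add: mult.assoc exp_add[symmetric])

lemma abs_mult_exp_le: "\<bar>r\<bar> * exp (- (r\<^sup>2 / 4)) \<le> 1" for r :: real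
  using abs_le_exp_square[of r] by (intro mult_exp_minus_le) simp

lemma exp_half_square_split: "exp (- (r\<^sup>2 / 2)) = exp (- (r\<^sup>2 / 4)) * exp (- (r\<^sup>2 / 4))" for r :: real
  unfolding exp_add[symmetric] by simp

lemma lipschitz_gaussian:
  "1-lipschitz_on UNIV (\<lambda>u::'a::real_normed_vector. exp (- ((norm u)\<^sup>2 / 2)))"
proof (rule lipschitz_radial)
  show "((\<lambda>r. exp (- (r\<^sup>2 / 2))) has_real_derivative - r * exp (- (r\<^sup>2 / 2))) (at r)" for r :: real
    by (auto intro!: derivative_eq_intros)
  show "\<bar>- r * exp (- (r\<^sup>2 / 2))\<bar> \<le> 1" for r :: real
  proof -
    have "\<bar>r\<bar> * exp (- (r\<^sup>2 / 4)) * exp (- (r\<^sup>2 / 4)) \<le> 1 * 1"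
      using abs_mult_exp_le by (intro mult_mono) auto
    then show ?thesis by (simp add: exp_half_square_split abs_mult mult.assoc)
  qed
qed

text \<open>The derivative of the radial profile is bounded by \<open>(\<bar>r\<bar> e) ((1 + r\<^sup>2 / 2) e)\<close> with
\<open>e = exp (- (r\<^sup>2 / 4))\<close>; splitting the Gaussian evenly makes both factors bounded.\<close>

lemma lipschitz_gaussian_energy:
  "3-lipschitz_on UNIV (\<lambda>u::'a::real_normed_vector. (norm u)\<^sup>2 / 2 * exp (- ((norm u)\<^sup>2 / 2)))"
proof (rule lipschitz_radial)
  show "((\<lambda>r. r\<^sup>2 / 2 * exp (- (r\<^sup>2 / 2))) has_real_derivative
      (r - r * (r\<^sup>2 / 2)) * exp (- (r\<^sup>2 / 2))) (at r)" for r :: real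
    by (auto intro!: derivative_eq_intros simp: field_simps power2_eq_square)
  show "\<bar>(r - r * (r\<^sup>2 / 2)) * exp (- (r\<^sup>2 / 2))\<bar> \<le> 3" for r :: real
  proof -
    define q where "q = \<bar>r\<bar> * exp (- (r\<^sup>2 / 4))"
    have q: "0 \<le> q" "q \<le> 1" using abs_mult_exp_le[of r] by (auto simp: q_def)
    define t where "t = (1 + r\<^sup>2 / 2) * exp (- (r\<^sup>2 / 4))"
    have "1 + r\<^sup>2 / 2 \<le> 2 * (1 + r\<^sup>2 / 4)" by simp
    also have "\<dots> \<le> 2 * exp (r\<^sup>2 / 4)" by (intro mult_left_mono exp_ge_add_one_self) simp
    finally have t: "0 \<le> t" "t \<le> 2"
      unfolding t_def by (simp, intro mult_exp_minus_le)
    have "\<bar>r - r * (r\<^sup>2 / 2)\<bar> \<le> \<bar>r\<bar> * (1 + r\<^sup>2 / 2)"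
      using abs_triangle_ineq4[of r "r * (r\<^sup>2 / 2)"] by (simp add: abs_mult algebra_simps)
    then have "\<bar>(r - r * (r\<^sup>2 / 2)) * exp (- (r\<^sup>2 / 2))\<bar> \<le> \<bar>r\<bar> * (1 + r\<^sup>2 / 2) * exp (- (r\<^sup>2 / 2))"
      by (simp add: abs_mult mult_right_mono)
    also have "\<dots> = q * t"
      by (simp add: q_def t_def exp_half_square_split mult_ac)
    also have "\<dots> \<le> 1 * 2" using q t by (intro mult_mono) auto
    finally show ?thesis by simp
  qed
qed

lemma mult_exp_minus_le_1: "t * exp (- t) \<le> 1" for t :: real
proof -
  have "t \<le> exp t" using exp_ge_add_one_self[of t] by linarith
  then show ?thesis by (intro mult_exp_minus_le) simp
qed

section \<open>Uniform limit of the perplexity\<close>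

locale iid_sample = prob_space M + bounded_density \<Omega> \<rho> R \<mu>
  for M :: "'w measure" and \<Omega> :: "'a::euclidean_space set" and \<rho> R \<mu> +
  fixes X :: "nat \<Rightarrow> 'w \<Rightarrow> 'a"
  assumes indep: "indep_vars (\<lambda>_. borel) X {1..}"
    and distr: "\<And>k. k \<ge> 1 \<Longrightarrow> distr M borel (X k) = \<mu>"
begin

text \<open>The fluctuation around the mean is controlled by concentration, the mean by continuity of the density.\<close>

lemma kernel_sum_tendsto:
  fixes \<phi> :: "'a \<Rightarrow> real" and h :: "nat \<Rightarrow> real" and L :: real
  assumes \<phi>: "\<And>u. 0 \<le> \<phi> u" "\<And>u. \<phi> u \<le> 1" "L-lipschitz_on UNIV \<phi>" "integrable lborel \<phi>"
    and K: "compact K" "K \<subseteq> \<Omega>" and h: "admissible_bandwidth DIM('a) h"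
  shows "AE \<omega> in M. ((\<lambda>(n, x). (\<Sum>k=1..n. \<phi> ((x - X k \<omega>) /\<^sub>R h n)) / (n * h n ^ DIM('a) * \<rho> x))
     \<longlongrightarrow> (\<integral>u. \<phi> u \<partial>lborel)) (sequentially \<times>\<^sub>F principal K)"
proof -
  let ?d = "DIM('a)" and ?F = "sequentially \<times>\<^sub>F principal K"
  define E where "E n x = (\<integral>y. \<phi> ((x - y) /\<^sub>R h n) \<partial>\<mu>)" for n x
  define S where "S n x \<omega> = (\<Sum>k=1..n. \<phi> ((x - X k \<omega>) /\<^sub>R h n))" for n x \<omega>
  have hpos: "h n > 0" if "n \<ge> 1" for n
    using h that by (auto simp: admissible_bandwidth_def)
  have "AE \<omega> in M. \<forall>\<^sub>F n in sequentially. \<forall>x\<in>K.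
      \<bar>S n x \<omega> - n * E n x\<bar> \<le> inverse (real (Suc m)) * (n * h n ^ ?d)" for m
    unfolding S_def E_def
    by (rule uniform_kernel_concentration[OF indep distr \<phi>(1-3) compact_imp_bounded[OF K(1)] h
          integral_kernel_le[OF \<phi>(4,1) hpos]]) auto
  then have "AE \<omega> in M. \<forall>m. \<forall>\<^sub>F n in sequentially. \<forall>x\<in>K.
      \<bar>S n x \<omega> - n * E n x\<bar> \<le> inverse (real (Suc m)) * (n * h n ^ ?d)"
    unfolding AE_all_countable by (intro allI)
  then show ?thesis
  proof eventually_elim
    case (elim \<omega>)
    have dev: "((\<lambda>(n, x). S n x \<omega> / (n * h n ^ ?d * \<rho> x) - E n x / (h n ^ ?d * \<rho> x)) \<longlongrightarrow> 0) ?F"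
    proof (rule tendstoI)
      fix e :: real assume "e > 0"
      then obtain m where m: "inverse (real (Suc m)) < e / R"
        using reals_Archimedean[of "e / R"] R_pos by auto
      have "\<forall>\<^sub>F n in sequentially. \<forall>x\<in>K. \<bar>S n x \<omega> / (n * h n ^ ?d * \<rho> x) - E n x / (h n ^ ?d * \<rho> x)\<bar> < e"
        using elim[rule_format, of m] eventually_ge_at_top[of 1]
      proof eventually_elim
        case (elim n)
        show ?case
        proof
          fix x assume x: "x \<in> K"
          define w where "w = n * h n ^ ?d"
          have w: "w > 0" using hpos[OF elim(2)] elim(2) by (simp add: w_def)
          have \<rho>: "\<rho> x > 0" "1 / \<rho> x \<le> R"
            using bounds[of x] rho_pos[of x] R_pos K x by (auto simp: field_simps)
          have "S n x \<omega> / (n * h n ^ ?d * \<rho> x) - E n x / (h n ^ ?d * \<rho> x) = (S n x \<omega> - n * E n x) / w * (1 / \<rho> x)"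
            using elim(2) hpos[OF elim(2)] \<rho> by (simp add: w_def field_simps)
          also have "\<bar>\<dots>\<bar> = \<bar>S n x \<omega> - n * E n x\<bar> / w * (1 / \<rho> x)"
            using w \<rho> by (simp add: abs_mult)
          also have "\<dots> \<le> inverse (real (Suc m)) * R"
            using elim(1) x w \<rho> by (intro mult_mono) (auto simp: w_def divide_le_eq)
          also have "\<dots> < e" using m R_pos by (simp add: pos_less_divide_eq)
          finally show "\<bar>S n x \<omega> / (n * h n ^ ?d * \<rho> x) - E n x / (h n ^ ?d * \<rho> x)\<bar> < e" .
        qed
      qed
      then show "\<forall>\<^sub>F p in ?F. dist (case p of (n, x) \<Rightarrow> S n x \<omega> / (n * h n ^ ?d * \<rho> x) - E n x / (h n ^ ?d * \<rho> x)) 0 < e"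
        by (simp add: eventually_prod_principal_iff)
    qed
    have mean: "((\<lambda>(n, x). E n x / (h n ^ ?d * \<rho> x)) \<longlongrightarrow> (\<integral>u. \<phi> u \<partial>lborel)) ?F"
      unfolding E_def using h
      by (intro kernel_mean_tendsto \<phi> K) (auto simp: admissible_bandwidth_def)
    from tendsto_add[OF dev mean] show ?case
      by (simp add: S_def case_prod_unfold)
  qed
qed

text \<open>The perplexity is \<open>A * exp (B / A)\<close> for the kernel sums \<open>A\<close> and \<open>B\<close> of \<open>exp (- \<bar>u\<bar>\<^sup>2 / 2)\<close> and
\<open>\<bar>u\<bar>\<^sup>2 / 2 * exp (- \<bar>u\<bar>\<^sup>2 / 2)\<close>. The integrals of the kernels have ratio \<open>d / 2\<close>, so the exponential
contributes the factor \<open>exp 1\<close> under the root.\<close>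

lemma perplexity_tendsto:
  fixes h :: "nat \<Rightarrow> real"
  assumes K: "compact K" "K \<subseteq> \<Omega>" and h: "admissible_bandwidth DIM('a) h"
  shows "AE \<omega> in M. ((\<lambda>(n, x). perplexity (\<lambda>k. X k \<omega>) n x (h n) / (n * h n ^ DIM('a) * \<rho> x))
     \<longlongrightarrow> sqrt (2 * pi * exp 1) ^ DIM('a)) (sequentially \<times>\<^sub>F principal K)"
proof -
  let ?d = "DIM('a)" and ?F = "sequentially \<times>\<^sub>F principal K"
  let ?\<phi> = "\<lambda>u::'a. exp (- ((norm u)\<^sup>2 / 2))"
  let ?\<psi> = "\<lambda>u::'a. (norm u)\<^sup>2 / 2 * exp (- ((norm u)\<^sup>2 / 2))"
  let ?I = "sqrt (2 * pi) ^ ?d"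
  have hpos: "h n > 0" if "n \<ge> 1" for n
    using h that by (auto simp: admissible_bandwidth_def)
  define A where "A n x \<omega> = (\<Sum>k=1..n. ?\<phi> ((x - X k \<omega>) /\<^sub>R h n))" for n x \<omega>
  define B where "B n x \<omega> = (\<Sum>k=1..n. ?\<psi> ((x - X k \<omega>) /\<^sub>R h n))" for n x \<omega>
  define Q where "Q n x = n * h n ^ ?d * \<rho> x" for n x
  have \<phi>: "integrable lborel ?\<phi>" "(\<integral>u. ?\<phi> u \<partial>lborel) = ?I"
    using gaussian_integral[where 'a='a] by (auto simp: has_bochner_integral_iff)
  have \<psi>: "integrable lborel ?\<psi>" "(\<integral>u. ?\<psi> u \<partial>lborel) = ?d / 2 * ?I"
    using gaussian_second_moment[where 'a='a] by (auto simp only: has_bochner_integral_iff)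
  have "AE \<omega> in M. ((\<lambda>(n, x). A n x \<omega> / Q n x) \<longlongrightarrow> ?I) ?F"
    unfolding A_def Q_def \<phi>(2)[symmetric]
    by (rule kernel_sum_tendsto[OF _ _ lipschitz_gaussian \<phi>(1) K h]) auto
  moreover have "AE \<omega> in M. ((\<lambda>(n, x). B n x \<omega> / Q n x) \<longlongrightarrow> ?d / 2 * ?I) ?F"
    unfolding B_def Q_def \<psi>(2)[symmetric]
    by (rule kernel_sum_tendsto[OF _ mult_exp_minus_le_1 lipschitz_gaussian_energy \<psi>(1) K h]) auto
  ultimately show ?thesis
  proof eventually_elim
    case (elim \<omega>)
    have A: "((\<lambda>p. A (fst p) (snd p) \<omega> / Q (fst p) (snd p)) \<longlongrightarrow> ?I) ?F"
      and B: "((\<lambda>p. B (fst p) (snd p) \<omega> / Q (fst p) (snd p)) \<longlongrightarrow> ?d / 2 * ?I) ?F"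
      using elim by (simp_all add: case_prod_unfold)
    have "((\<lambda>p. A (fst p) (snd p) \<omega> / Q (fst p) (snd p) *
        exp (B (fst p) (snd p) \<omega> / Q (fst p) (snd p) / (A (fst p) (snd p) \<omega> / Q (fst p) (snd p))))
        \<longlongrightarrow> ?I * exp (?d / 2 * ?I / ?I)) ?F"
      by (intro tendsto_mult tendsto_exp tendsto_divide A B) auto
    moreover have "?I * exp (?d / 2 * ?I / ?I) = sqrt (2 * pi * exp 1) ^ ?d"
    proof -
      have "sqrt (exp 1) = exp (1 / 2 :: real)"
        by (intro real_sqrt_unique) (auto simp: power2_eq_square exp_add[symmetric])
      then have "exp (?d / 2) = sqrt (exp 1) ^ ?d"
        by (simp add: exp_of_nat_mult[symmetric])
      then show ?thesis by (simp add: real_sqrt_mult power_mult_distrib)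
    qed
    moreover have "\<forall>\<^sub>F p in ?F. A (fst p) (snd p) \<omega> / Q (fst p) (snd p) *
        exp (B (fst p) (snd p) \<omega> / Q (fst p) (snd p) / (A (fst p) (snd p) \<omega> / Q (fst p) (snd p))) =
        (case p of (n, x) \<Rightarrow> perplexity (\<lambda>k. X k \<omega>) n x (h n) / (n * h n ^ ?d * \<rho> x))"
      unfolding eventually_prod_principal_iff
      using eventually_ge_at_top[of 1]
    proof eventually_elim
      case (elim n)
      have "norm ((x - z) /\<^sub>R h n) = norm (x - z) / h n" for x z :: 'a
        using hpos[OF elim] by (simp add: divide_inverse_commute)
      then have "(norm ((x - z) /\<^sub>R h n))\<^sup>2 / 2 = (norm (x - z))\<^sup>2 / (2 * (h n)\<^sup>2)" for x z :: 'a
        by (simp only: power_divide divide_divide_eq_left mult.commute)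
      then have "perplexity (\<lambda>k. X k \<omega>) n x (h n) = A n x \<omega> * exp (B n x \<omega> / A n x \<omega>)" for x
        by (simp only: perplexity_def A_def B_def)
      moreover have "Q n x \<noteq> 0" if "x \<in> K" for x
        using elim hpos[OF elim] rho_pos[of x] that K by (auto simp: Q_def)
      ultimately show ?case by (simp add: Q_def[symmetric])
    qed
    ultimately show ?case by (simp add: tendsto_cong)
  qed
qed

section \<open>Convergence of the selected bandwidth\<close>

definition limit_bandwidth :: "real \<Rightarrow> 'a \<Rightarrow> real" where
  "limit_bandwidth \<kappa> x = 1 / sqrt (2 * pi * exp 1) * (\<kappa> / \<rho> x) powr (1 / real DIM('a))"

text \<open>The third identity characterises the limit: it is the factor \<open>s\<close> for which bandwidth \<open>h n * s\<close>
has asymptotic perplexity \<open>\<kappa> * n * h n ^ d\<close>.\<close>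

lemma limit_bandwidth:
  assumes "\<kappa> > 0" "x \<in> \<Omega>"
  shows "0 < limit_bandwidth \<kappa> x"
    and "limit_bandwidth \<kappa> x \<le> 1 / sqrt (2 * pi * exp 1) * (\<kappa> * R) powr (1 / real DIM('a))"
    and "sqrt (2 * pi * exp 1) ^ DIM('a) * limit_bandwidth \<kappa> x ^ DIM('a) = \<kappa> / \<rho> x"
proof -
  have \<rho>: "\<rho> x > 0" "1 / \<rho> x \<le> R"
    using bounds[OF assms(2)] rho_pos[OF assms(2)] R_pos by (auto simp: field_simps)
  then have pos: "\<kappa> / \<rho> x > 0" using assms by simp
  then show "0 < limit_bandwidth \<kappa> x"
    unfolding limit_bandwidth_def by (intro mult_pos_pos divide_pos_pos) auto
  have "\<kappa> / \<rho> x \<le> \<kappa> * R"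
    using mult_left_mono[OF \<rho>(2), of \<kappa>] assms by simp
  then show "limit_bandwidth \<kappa> x \<le> 1 / sqrt (2 * pi * exp 1) * (\<kappa> * R) powr (1 / real DIM('a))"
    unfolding limit_bandwidth_def using pos by (intro mult_left_mono powr_mono2) auto
  have "((\<kappa> / \<rho> x) powr (1 / real DIM('a))) ^ DIM('a) = \<kappa> / \<rho> x"
    using pos assms \<rho> by (subst powr_power) auto
  then show "sqrt (2 * pi * exp 1) ^ DIM('a) * limit_bandwidth \<kappa> x ^ DIM('a) = \<kappa> / \<rho> x"
    by (simp add: limit_bandwidth_def power_mult_distrib power_divide)
qed

text \<open>The asymptotics of the perplexity hold almost surely for each fixed factor \<open>s\<close> of the bandwidth,
hence simultaneously for the finitely many \<open>s\<close> in a grid of mesh \<open>\<epsilon> / 2\<close>. For each point \<open>x\<close> some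
grid factor lies between \<open>\<epsilon> / 2\<close> and \<open>\<epsilon>\<close> above the limit, and its perplexity asymptotically
exceeds the prescribed value by a fixed proportion; as the perplexity is monotone, \<open>\<sigma> n \<omega> x\<close> stays
below that factor. The lower bound is symmetric.\<close>

lemma bandwidth_close:
  fixes h :: "nat \<Rightarrow> real" and \<sigma> :: "nat \<Rightarrow> 'w \<Rightarrow> 'a \<Rightarrow> real" and \<kappa> \<epsilon> :: real
  assumes K: "compact K" "K \<subseteq> \<Omega>" and h: "admissible_bandwidth DIM('a) h" and \<kappa>: "\<kappa> > 0"
    and \<sigma>: "AE \<omega> in M. \<forall>\<^sub>F n in sequentially. \<forall>x\<in>\<Omega>. \<sigma> n \<omega> x > 0 \<and>
           perplexity (\<lambda>k. X k \<omega>) n x (h n * \<sigma> n \<omega> x) = \<kappa> * real n * h n ^ DIM('a)"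
    and \<epsilon>: "\<epsilon> > 0"
  shows "AE \<omega> in M. \<forall>\<^sub>F n in sequentially. \<forall>x\<in>K. \<bar>\<sigma> n \<omega> x - limit_bandwidth \<kappa> x\<bar> \<le> \<epsilon>"
proof -
  let ?d = "DIM('a)"
  define c where "c = sqrt (2 * pi * exp 1) ^ ?d"
  have c: "c > 0" by (simp add: c_def)
  define b where "b = 1 / sqrt (2 * pi * exp 1) * (\<kappa> * R) powr (1 / real ?d)"
  have b: "b > 0" using \<kappa> R_pos by (simp add: b_def)
  define \<tau> where "\<tau> = \<epsilon> / 2"
  have \<tau>: "\<tau> > 0" using \<epsilon> by (simp add: \<tau>_def)
  \<comment> \<open>A grid factor that misses the limit by at least \<open>\<tau>\<close> changes the asymptotic perplexity by at least
    the proportion \<open>\<eta>\<close>, uniformly in \<open>x\<close>; the factors needed are at most \<open>b + \<epsilon>\<close>.\<close>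
  define \<eta> where "\<eta> = \<tau> / (b + \<epsilon>)"
  have \<eta>: "\<eta> > 0" using \<tau> b \<epsilon> by (simp add: \<eta>_def)
  define J where "J = nat \<lceil>b / \<tau> + 2\<rceil>"
  define P where "P \<omega> n x s = perplexity (\<lambda>k. X k \<omega>) n x (h n * s) / (n * (h n * s) ^ ?d * \<rho> x)" for \<omega> n x s
  have hpos: "h n > 0" if "n \<ge> 1" for n
    using h that by (auto simp: admissible_bandwidth_def)
  have "AE \<omega> in M. \<forall>j\<in>{1..J}. ((\<lambda>(n, x). P \<omega> n x (real j * \<tau>)) \<longlongrightarrow> c) (sequentially \<times>\<^sub>F principal K)"
    unfolding P_def c_def using \<tau>
    by (intro AE_finite_allI perplexity_tendsto[OF K admissible_bandwidth_scale[OF h]]) auto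
  with \<sigma> show ?thesis
  proof eventually_elim
    case (elim \<omega>)
    have "\<forall>\<^sub>F n in sequentially. \<forall>j\<in>{1..J}. \<forall>x\<in>K. dist (P \<omega> n x (real j * \<tau>)) c < c * \<eta>"
    proof (rule eventually_ball_finite[OF _ ballI])
      fix j assume "j \<in> {1..J}"
      then have "\<forall>\<^sub>F p in sequentially \<times>\<^sub>F principal K. dist (case p of (n, x) \<Rightarrow> P \<omega> n x (real j * \<tau>)) c < c * \<eta>"
        using elim(2) c \<eta> by (intro tendstoD) auto
      then show "\<forall>\<^sub>F n in sequentially. \<forall>x\<in>K. dist (P \<omega> n x (real j * \<tau>)) c < c * \<eta>"
        by (simp add: eventually_prod_principal_iff)
    qed simp
    with elim(1) show ?case
      using eventually_ge_at_top[of 1]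
    proof eventually_elim
      case (elim n)
      show ?case
      proof
        fix x assume x: "x \<in> K"
        then have x\<Omega>: "x \<in> \<Omega>" using K by auto
        define s0 where "s0 = limit_bandwidth \<kappa> x"
        have s0: "0 < s0" "s0 \<le> b" "c * s0 ^ ?d = \<kappa> / \<rho> x"
          using limit_bandwidth[OF \<kappa> x\<Omega>] by (auto simp: s0_def b_def c_def)
        have \<sigma>: "\<sigma> n \<omega> x > 0" "perplexity (\<lambda>k. X k \<omega>) n x (h n * \<sigma> n \<omega> x) = \<kappa> * n * h n ^ ?d"
          using elim(1) x\<Omega> by auto
        have w: "n * h n ^ ?d * \<rho> x > 0"
          using elim(3) hpos[OF elim(3)] rho_pos[OF x\<Omega>] by simp
        have ratio: "\<kappa> * n * h n ^ ?d / (n * (h n * s) ^ ?d * \<rho> x) = c * (s0 / s) ^ ?d" if "s > 0" for s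
        proof -
          have "c * (s0 / s) ^ ?d = \<kappa> / \<rho> x / s ^ ?d"
            by (simp add: power_divide s0(3)[symmetric])
          then show ?thesis using w that elim(3) hpos[OF elim(3)] rho_pos[OF x\<Omega>]
            by (simp add: power_mult_distrib field_simps)
        qed
        have grid: "\<bar>P \<omega> n x (real j * \<tau>) - c\<bar> < c * \<eta>" if "j \<ge> 1" "real j \<le> b / \<tau> + 2" for j
        proof -
          have "j \<in> {1..J}" using that unfolding J_def by (auto simp: le_nat_iff) linarith
          then show ?thesis using elim(2) x by (auto simp: dist_real_def)
        qed
        have "\<sigma> n \<omega> x \<le> s0 + \<epsilon>"
        proof (rule ccontr)
          assume large: "\<not> \<sigma> n \<omega> x \<le> s0 + \<epsilon>"
          define j where "j = nat (\<lceil>s0 / \<tau>\<rceil> + 1)"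
          define s where "s = real j * \<tau>"
          have "0 < s0 / \<tau>" using s0 \<tau> by simp
          then have j: "j \<ge> 1" "s0 / \<tau> + 1 \<le> real j" "real j \<le> s0 / \<tau> + 2"
            unfolding j_def by linarith+
          have "s0 / \<tau> \<le> b / \<tau>" using s0 \<tau> by (intro divide_right_mono) auto
          with j grid have P: "\<bar>P \<omega> n x s - c\<bar> < c * \<eta>" unfolding s_def by auto
          have s: "s0 + \<tau> \<le> s" "s \<le> s0 + \<epsilon>" "s > 0"
            using j \<tau> s0 by (auto simp: s_def \<tau>_def field_simps)
          have "perplexity (\<lambda>k. X k \<omega>) n x (h n * s) \<le> perplexity (\<lambda>k. X k \<omega>) n x (h n * \<sigma> n \<omega> x)"
            using s large elim(3) hpos[OF elim(3)] by (intro perplexity_mono mult_left_mono) auto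
          then have "P \<omega> n x s \<le> c * (s0 / s) ^ ?d"
            unfolding P_def ratio[OF s(3), symmetric] \<sigma>(2)
            using w s hpos[OF elim(3)] rho_pos[OF x\<Omega>] by (intro divide_right_mono) auto
          also have "(s0 / s) ^ ?d \<le> (s0 / s) ^ 1"
            using s0 s \<tau> by (intro power_decreasing) auto
          also have "s0 / s \<le> 1 - \<eta>"
          proof -
            have "\<eta> \<le> \<tau> / s"
              unfolding \<eta>_def using s s0 b \<tau> \<epsilon> by (intro divide_left_mono) auto
            also have "\<dots> \<le> (s - s0) / s" using s by (intro divide_right_mono) auto
            finally show ?thesis using s by (simp add: diff_divide_distrib)
          qed
          finally have "P \<omega> n x s \<le> c * (1 - \<eta>)" using c by simp
          with P show False by (simp add: algebra_simps)
        qed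
        moreover have "s0 - \<epsilon> \<le> \<sigma> n \<omega> x"
        proof (rule ccontr)
          assume small: "\<not> s0 - \<epsilon> \<le> \<sigma> n \<omega> x"
          \<comment> \<open>Positivity of \<open>\<sigma>\<close> guarantees that the grid factor chosen below the limit is positive.\<close>
          then have "s0 > \<epsilon>" using \<sigma>(1) by linarith
          then have "s0 / \<tau> > 2" using \<tau> by (simp add: \<tau>_def field_simps)
          define j where "j = nat (\<lfloor>s0 / \<tau>\<rfloor> - 1)"
          define s where "s = real j * \<tau>"
          have j: "j \<ge> 1" "s0 / \<tau> - 2 \<le> real j" "real j \<le> s0 / \<tau> - 1"
            unfolding j_def using \<open>s0 / \<tau> > 2\<close> by linarith+
          have "s0 / \<tau> \<le> b / \<tau>" using s0 \<tau> by (intro divide_right_mono) auto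
          with j grid have P: "\<bar>P \<omega> n x s - c\<bar> < c * \<eta>" unfolding s_def by auto
          have s: "s0 - \<epsilon> \<le> s" "s \<le> s0 - \<tau>" "s > 0"
            using j \<tau> s0 by (auto simp: s_def \<tau>_def field_simps)
          have "perplexity (\<lambda>k. X k \<omega>) n x (h n * \<sigma> n \<omega> x) \<le> perplexity (\<lambda>k. X k \<omega>) n x (h n * s)"
            using s small elim(3) hpos[OF elim(3)] \<sigma>(1) by (intro perplexity_mono mult_left_mono) auto
          then have le: "c * (s0 / s) ^ ?d \<le> P \<omega> n x s"
            unfolding P_def ratio[OF s(3), symmetric] \<sigma>(2)
            using w s hpos[OF elim(3)] rho_pos[OF x\<Omega>] by (intro divide_right_mono) auto
          have "1 + \<eta> \<le> s0 / s"
          proof -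
            have "\<eta> \<le> \<tau> / s"
              unfolding \<eta>_def using s s0 b \<tau> \<epsilon> by (intro divide_left_mono) auto
            also have "\<dots> \<le> (s0 - s) / s" using s by (intro divide_right_mono) auto
            finally show ?thesis using s by (simp add: diff_divide_distrib)
          qed
          also have "(s0 / s) ^ 1 \<le> (s0 / s) ^ ?d"
            using s \<tau> DIM_positive[where 'a='a] by (intro power_increasing) (auto simp: Suc_le_eq)
          finally have "c * (1 + \<eta>) \<le> c * (s0 / s) ^ ?d" using c by simp
          with le P show False by (simp add: algebra_simps)
        qed
        ultimately show "\<bar>\<sigma> n \<omega> x - limit_bandwidth \<kappa> x\<bar> \<le> \<epsilon>" by (simp add: s0_def)
      qed
    qed
  qed
qed

end

lemma Linf_norm_tendsto_0:
  assumes "\<And>m. \<forall>\<^sub>F n in sequentially. \<forall>x\<in>S. \<bar>f n x\<bar> \<le> inverse (real (Suc m))"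
  shows "(\<lambda>n. Linf_norm S (f n)) \<longlonglongrightarrow> 0"
proof (rule tendsto_zero_ennreal)
  fix r :: real assume "r > 0"
  then obtain m where m: "inverse (real (Suc m)) < r"
    using reals_Archimedean by blast
  from assms[of m] show "\<forall>\<^sub>F n in sequentially. Linf_norm S (f n) < ennreal r"
  proof eventually_elim
    case (elim n)
    then have "Linf_norm S (f n) \<le> ennreal (inverse (real (Suc m)))"
      unfolding Linf_norm_def by (intro Inf_lower) (auto intro!: ennreal_leI)
    also have "\<dots> < ennreal r" using m \<open>r > 0\<close> by (simp add: ennreal_less_iff)
    finally show ?case .
  qed
qed

theorem proposition2p2:
  fixes \<Omega> \<Omega>' :: "'a::euclidean_space set"
    and \<mu> :: "'a measure"
    and \<rho> :: "'a \<Rightarrow> real" and \<rho>_star :: real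
    and M :: "'w measure" and X :: "nat \<Rightarrow> 'w \<Rightarrow> 'a"
    and \<kappa> :: real and h :: "nat \<Rightarrow> real"
    and \<sigma> :: "nat \<Rightarrow> 'w \<Rightarrow> 'a \<Rightarrow> real"
  assumes "C2_domain \<Omega>" and "bounded \<Omega>"
    and "\<mu> = density lborel (\<lambda>x. ennreal (\<rho> x) * indicator \<Omega> x)" and "prob_space \<mu>"
    and "uniformly_continuous_on \<Omega> \<rho>"
    and "\<And>x. x \<in> \<Omega> \<Longrightarrow> 1 / \<rho>_star < \<rho> x \<and> \<rho> x < \<rho>_star"
    and "prob_space M"
    and "prob_space.indep_vars M (\<lambda>_. borel) X {1..}"
    and "\<And>k. k \<ge> 1 \<Longrightarrow> distr M borel (X k) = \<mu>"
    and "\<kappa> > 0"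
    and "\<And>n. n \<ge> 1 \<Longrightarrow> h n > 0" and "h \<longlonglongrightarrow> 0"
    and "filterlim (\<lambda>n. real n * h n ^ DIM('a) / ln (real n)) at_top sequentially"
    and "AE \<omega> in M. \<forall>\<^sub>F n in sequentially. \<forall>x\<in>\<Omega>. \<sigma> n \<omega> x > 0 \<and>
           perplexity (\<lambda>k. X k \<omega>) n x (h n * \<sigma> n \<omega> x) = \<kappa> * real n * h n ^ DIM('a)"
    and "compact (closure \<Omega>')" and "closure \<Omega>' \<subseteq> \<Omega>"
  shows "AE \<omega> in M.
    (\<lambda>n. Linf_norm \<Omega>' (\<lambda>x. \<sigma> n \<omega> x -
        1 / sqrt (2 * pi * exp 1) * (\<kappa> / \<rho> x) powr (1 / real DIM('a)))) \<longlonglongrightarrow> 0"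
proof -
  \<comment> \<open>If \<open>\<rho>_star\<close> were not positive, the density would be negative on \<open>\<Omega>\<close> and \<open>\<mu>\<close> would vanish.\<close>
  have R: "\<rho>_star > 0"
  proof (rule ccontr)
    assume "\<not> \<rho>_star > 0"
    then have "ennreal (\<rho> x) * indicator \<Omega> x = 0" for x
      using assms(6)[of x] by (cases "x \<in> \<Omega>") (auto intro!: ennreal_neg)
    then have "\<mu> = density lborel (\<lambda>_. 0)" unfolding assms(3) by (simp only:)
    then have "emeasure \<mu> (space \<mu>) = 0" by (simp add: emeasure_density)
    then show False using prob_space.emeasure_space_1[OF assms(4)] by simp
  qed
  interpret prob_space M by fact
  interpret iid_sample M \<Omega> \<rho> \<rho>_star \<mu> X
    using assms R by unfold_locales (auto simp: C2_domain_def)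
  have h: "admissible_bandwidth DIM('a) h"
    using assms by (auto simp: admissible_bandwidth_def)
  have "AE \<omega> in M. \<forall>\<^sub>F n in sequentially. \<forall>x\<in>closure \<Omega>'.
      \<bar>\<sigma> n \<omega> x - limit_bandwidth \<kappa> x\<bar> \<le> inverse (real (Suc m))" for m
    using assms by (intro bandwidth_close[OF _ _ h]) auto
  then have "AE \<omega> in M. \<forall>m. \<forall>\<^sub>F n in sequentially. \<forall>x\<in>closure \<Omega>'.
      \<bar>\<sigma> n \<omega> x - limit_bandwidth \<kappa> x\<bar> \<le> inverse (real (Suc m))"
    unfolding AE_all_countable by (intro allI)
  then show ?thesis
  proof eventually_elim
    case (elim \<omega>)
    show ?case
      unfolding limit_bandwidth_def[symmetric]
    proof (rule Linf_norm_tendsto_0)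
      show "\<forall>\<^sub>F n in sequentially. \<forall>x\<in>\<Omega>'. \<bar>\<sigma> n \<omega> x - limit_bandwidth \<kappa> x\<bar> \<le> inverse (real (Suc m))" for m
        using elim[rule_format, of m] by eventually_elim (use closure_subset in blast)
    qed
  qed
qed

end
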